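(* Let $Z\sim p$ belong to the integrated Pearson family, and let $n\ge1$ be admissible. Let $h$ satisfy the regularity requirements given in the context. (i) If $w$ is such that $(\tau_p/w)''$ is constant, then $(M_{p,w}^{n,n-1})'=-(1/w)'$, and hence $$f_{p,w,h}^{(n)}(x)=\mathbb E\big[K_{p,w}^{n,n-1}(x,Z)\big(h^{(n-1)}(Z)-h^{(n-1)}(x)\big)\big].$$ (ii) If $(\tau_p/w)'$ is constant, then $M_{p,w}^{n,n-1}=-1/w$, and therefore $$f_{p,w,h}^{(n)}(x)=\mathbb E\big[K_{p,w}^{n,n}(x,Z)h^{(n)}(Z)\big],$$ $$f_{p,w,h}^{(n)}(x)=\mathbb E\big[K_{p,w}^{n,n+1}(x,Z)h^{(n+1)}(Z)\big]-\frac n{q_n}\Big(\frac{\tau_p}{w}\Big)'(x)\,h^{(n)}(x).$$ (iii) In particular, if $w=\tau_p$, the pointwise term in the last formula vanishes, giving $$f_{p,\tau_p,h}^{(n)}(x)=\mathbb E\big[K_{p,\tau_p}^{n,n+1}(x,Z)h^{(n+1)}(Z)\big].$$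
   Context: Setting. $p$ is a probability density on $\mathbb R$ and $Z$ a random variable with density $p$. There are $m\ge1$ and $-\infty\le l=e_0<e_1<\dots<e_m=u\le\infty$ with $\{p>0\}=\mathcal I_p:=\bigcup_{r=1}^m(e_{r-1},e_r)$, and $p$ is locally absolutely continuous on each $(e_{r-1},e_r)$. The weight $w:\mathbb R\to\mathbb R$ is nonzero on $\mathcal I_p$ and $wp$ is locally absolutely continuous on each $(e_{r-1},e_r)$. Put $P(x)=\int_l^xp$, $\overline P(x)=\int_x^up$, $\mathcal Ph=\mathbb E[h(Z)]$. For $h\in L^1(p)$, the Stein solution is $f_{p,w,h}(x)=\frac1{w(x)p(x)}\int_l^x(h(t)-\mathcal Ph)p(t)\,dt$, $x\in\mathcal I_p$. It satisfies $f_{p,w,h}(x)=\mathbb E[K^{0,0}_{p,w}(x,Z)h(Z)]$ with the kernel defined below. Integrated Pearson family. $Z$ has finite mean $\mu$ and its Stein kernel $\tau_p(x)=\frac1{p(x)}\int_l^x(\mu-t)p(t)\,dt$ is, on $\mathcal I_p$, a polynomial $\tau_p(x)=\kappa_2x^2+\kappa_1x+\kappa_0$. Put $q_k=k(1-(k-1)\kappa_2)$. An integer $k\ge0$ is admissible if $q_j>0$ for every $1\le j\le k$. Kernels. $\underline m_{p,w}=P/(wp)$ and $\overline m_{p,w}=\overline P/(wp)$ on $\mathcal I_p$; $\underline P_0=\overline P_0=p$ and, for $j\ge1$, $\underline P_j(x)=\int_l^x\underline P_{j-1}(t)\,dt$, $\overline P_j(x)=\int_x^u\overline P_{j-1}(t)\,dt$.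 For $i,j\ge0$ and $x,v\in\mathcal I_p$, $$K_{p,w}^{i,j}(x,v)=\frac1{p(v)}\Big[(-1)^j\overline m_{p,w}^{(i)}(x)\underline P_j(v)\mathbf 1_{\{v\le x\}}-\underline m_{p,w}^{(i)}(x)\overline P_j(v)\mathbf 1_{\{v>x\}}\Big],$$ and for $i\ge0$, $j\ge-1$, $M_{p,w}^{i,j}=(-1)^j\overline m_{p,w}^{(i)}\underline P_{j+1}-\underline m_{p,w}^{(i)}\overline P_{j+1}$. Superscripts in parentheses are ordinary derivatives. Regularity requirements. $h\in L^1(p)$, $h^{(n-1)}$ is locally absolutely continuous, the derivatives and integrals displayed exist, and the two kernel identities $$\mathbb E[K_{p,w}^{i,j}(x,Z)g(Z)]=\mathbb E[K_{p,w}^{i,j+1}(x,Z)g'(Z)]+M_{p,w}^{i,j}(x)g(x),$$ $$\frac{d}{dx}\mathbb E[K_{p,w}^{i,j}(x,Z)g(Z)]=\mathbb E[K_{p,w}^{i+1,j}(x,Z)g(Z)]-M_{p,w}^{i,j-1}(x)g(x)$$ (integration by parts and differentiation, valid under suitable integrability and vanishing of endpoint terms) apply with $g$ a derivative of $h$ at every index used to pass from $f_{p,w,h}=\mathbb E[K^{0,0}_{p,w}(\cdot,Z)h(Z)]$ to the representation in question. For the representations involving $h^{(n+1)}$, $h^{(n)}$ is in addition locally absolutely continuous and the first identity is also applicable with $(i,j)=(n,n)$, $g=h^{(n)}$.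
   Formalization: In (i) the representation gains the term (M^{n,n-1}+1/w)(x)h^{(n-1)}(x); the printed formula is kept only for n=1 or (τ_p/w)''=0, since it fails otherwise (Z standard normal, w=1/(1+x²), h(x)=x, n=2: f''=-2 but the expectation is 0). *)

theory Defs
  imports "HOL-Probability.Probability"
begin

definition locally_abs_cont_on :: "(real \<Rightarrow> real) \<Rightarrow> real set \<Rightarrow> bool" where
  "locally_abs_cont_on f S \<longleftrightarrow>
     (\<forall>a b. a \<le> b \<and> {a..b} \<subseteq> S \<longrightarrow>
       (\<forall>\<epsilon>>0. \<exists>\<delta>>0. \<forall>D. finite D \<and> (\<forall>(s, t)\<in>D. a \<le> s \<and> s \<le> t \<and> t \<le> b) \<and>
           pairwise (\<lambda>(s, t) (s', t'). {s<..<t} \<inter> {s'<..<t'} = {}) D \<and>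
           (\<Sum>(s, t)\<in>D. t - s) < \<delta> \<longrightarrow>
         (\<Sum>(s, t)\<in>D. \<bar>f t - f s\<bar>) < \<epsilon>))"

text \<open>
  \<open>f\<^sup>(\<^sup>n\<^sup>)\<close> is written \<open>(deriv ^^ n) f\<close>; since \<^const>\<open>deriv\<close> is total, existence of the
  derivatives is recorded separately.
\<close>

definition times_differentiable_on :: "nat \<Rightarrow> (real \<Rightarrow> real) \<Rightarrow> real set \<Rightarrow> bool" where
  "times_differentiable_on n f S \<longleftrightarrow> (\<forall>k<n. \<forall>x\<in>S. (deriv ^^ k) f differentiable (at x))"

definition supp_set :: "nat \<Rightarrow> (nat \<Rightarrow> ereal) \<Rightarrow> real set" where
  "supp_set m e = (\<Union>r\<in>{1..m}. einterval (e (r - 1)) (e r))"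

locale stein_setting = prob_space M
  for M :: "'a measure" +
  fixes Z :: "'a \<Rightarrow> real" and p w :: "real \<Rightarrow> real" and m :: nat and e :: "nat \<Rightarrow> ereal"
  assumes density_Z: "distributed M lborel Z (\<lambda>x. ennreal (p x))"
    and p_nonneg: "\<And>x. 0 \<le> p x"
    and m_pos: "1 \<le> m"
    and e_less: "\<And>r. r \<in> {1..m} \<Longrightarrow> e (r - 1) < e r"
    and p_pos_set: "{x. 0 < p x} = supp_set m e"
    and p_lac: "\<And>r. r \<in> {1..m} \<Longrightarrow> locally_abs_cont_on p (einterval (e (r - 1)) (e r))"
    and w_nonzero: "\<And>x. x \<in> supp_set m e \<Longrightarrow> w x \<noteq> 0"
    and wp_lac: "\<And>r. r \<in> {1..m} \<Longrightarrow>
      locally_abs_cont_on (\<lambda>x. w x * p x) (einterval (e (r - 1)) (e r))"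

fun lowerP :: "(real \<Rightarrow> real) \<Rightarrow> ereal \<Rightarrow> nat \<Rightarrow> real \<Rightarrow> real" where
  "lowerP p l 0 x = p x"
| "lowerP p l (Suc j) x = (LBINT t=l..ereal x. lowerP p l j t)"

fun upperP :: "(real \<Rightarrow> real) \<Rightarrow> ereal \<Rightarrow> nat \<Rightarrow> real \<Rightarrow> real" where
  "upperP p u 0 x = p x"
| "upperP p u (Suc j) x = (LBINT t=ereal x..u. upperP p u j t)"

definition m_lower :: "(real \<Rightarrow> real) \<Rightarrow> (real \<Rightarrow> real) \<Rightarrow> ereal \<Rightarrow> real \<Rightarrow> real" where
  "m_lower p w l x = lowerP p l 1 x / (w x * p x)"

definition m_upper :: "(real \<Rightarrow> real) \<Rightarrow> (real \<Rightarrow> real) \<Rightarrow> ereal \<Rightarrow> real \<Rightarrow> real" where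
  "m_upper p w u x = upperP p u 1 x / (w x * p x)"

definition stein_K ::
  "(real \<Rightarrow> real) \<Rightarrow> (real \<Rightarrow> real) \<Rightarrow> ereal \<Rightarrow> ereal \<Rightarrow> nat \<Rightarrow> nat \<Rightarrow> real \<Rightarrow> real \<Rightarrow> real" where
  "stein_K p w l u i j x v = 1 / p v *
     ((-1) ^ j * (deriv ^^ i) (m_upper p w u) x * lowerP p l j v * indicator {..x} v
      - (deriv ^^ i) (m_lower p w l) x * upperP p u j v * indicator {x<..} v)"

text \<open>The second index ranges over \<open>j \<ge> -1\<close>.\<close>

definition stein_M ::
  "(real \<Rightarrow> real) \<Rightarrow> (real \<Rightarrow> real) \<Rightarrow> ereal \<Rightarrow> ereal \<Rightarrow> nat \<Rightarrow> int \<Rightarrow> real \<Rightarrow> real" where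
  "stein_M p w l u i j x =
     (-1) powi j * (deriv ^^ i) (m_upper p w u) x * lowerP p l (nat (j + 1)) x
     - (deriv ^^ i) (m_lower p w l) x * upperP p u (nat (j + 1)) x"

text \<open>
  When \<open>(\<tau>\<^sub>p/w)'' = c\<close> is constant in the Pearson family, \<open>M\<^sup>n\<^sup>,\<^sup>n\<^sup>-\<^sup>1 + 1/w\<close> is the constant
  \<open>-(n choose 2) c / q\<^sub>n\<^sub>-\<^sub>1\<close>, which is nonzero for \<open>n \<ge> 2\<close> and \<open>c \<noteq> 0\<close>; the representation
  through \<open>K\<^sup>n\<^sup>,\<^sup>n\<^sup>-\<^sup>1\<close> centred at \<open>h\<^sup>(\<^sup>n\<^sup>-\<^sup>1\<^sup>)(x)\<close> then carries \<open>(M\<^sup>n\<^sup>,\<^sup>n\<^sup>-\<^sup>1 + 1/w)(x) h\<^sup>(\<^sup>n\<^sup>-\<^sup>1\<^sup>)(x)\<close>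
  as an additional term. Example: \<open>Z\<close> standard normal, \<open>n = 2\<close>, \<open>w(x) = 1/(1 + x\<^sup>2)\<close>, \<open>h(x) = x\<close>,
  where \<open>f(x) = -(1 + x\<^sup>2)\<close> and the expectation of the centred kernel vanishes.
\<close>

definition stein_kernel :: "(real \<Rightarrow> real) \<Rightarrow> ereal \<Rightarrow> real \<Rightarrow> real \<Rightarrow> real" where
  "stein_kernel p l \<mu> x = 1 / p x * (LBINT t=l..ereal x. (\<mu> - t) * p t)"

text \<open>The argument \<open>Eh\<close> is the mean \<open>E[h(Z)]\<close>.\<close>

definition stein_solution ::
  "(real \<Rightarrow> real) \<Rightarrow> (real \<Rightarrow> real) \<Rightarrow> ereal \<Rightarrow> real \<Rightarrow> (real \<Rightarrow> real) \<Rightarrow> real \<Rightarrow> real" where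
  "stein_solution p w l Eh h x = 1 / (w x * p x) * (LBINT t=l..ereal x. (h t - Eh) * p t)"

definition pearson_q :: "real \<Rightarrow> nat \<Rightarrow> real" where
  "pearson_q \<kappa>2 k = real k * (1 - (real k - 1) * \<kappa>2)"

definition admissible :: "real \<Rightarrow> nat \<Rightarrow> bool" where
  "admissible \<kappa>2 k \<longleftrightarrow> (\<forall>j\<in>{1..k}. 0 < pearson_q \<kappa>2 j)"

context stein_setting
begin

abbreviation supp :: "real set" where "supp \<equiv> supp_set m e"
abbreviation K :: "nat \<Rightarrow> nat \<Rightarrow> real \<Rightarrow> real \<Rightarrow> real" where "K \<equiv> stein_K p w (e 0) (e m)"
abbreviation MM :: "nat \<Rightarrow> int \<Rightarrow> real \<Rightarrow> real" where "MM \<equiv> stein_M p w (e 0) (e m)"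

definition integrated_pearson :: "real \<Rightarrow> real \<Rightarrow> real \<Rightarrow> bool" where
  "integrated_pearson \<kappa>2 \<kappa>1 \<kappa>0 \<longleftrightarrow> integrable M Z \<and>
     (\<forall>x\<in>supp. stein_kernel p (e 0) (expectation Z) x = \<kappa>2 * x\<^sup>2 + \<kappa>1 * x + \<kappa>0)"

text \<open>
  Applicability of the two kernel identities with indices \<open>(i, j)\<close> to \<open>g\<close>: integration by
  parts, and differentiation in \<open>x\<close>. The function \<open>g\<close> in the former may be only locally
  absolutely continuous, in which case \<open>deriv g\<close> is its a.e. derivative.
\<close>

definition kernel_parts :: "nat \<Rightarrow> nat \<Rightarrow> (real \<Rightarrow> real) \<Rightarrow> bool" where
  "kernel_parts i j g \<longleftrightarrow> (\<forall>x\<in>supp.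
     integrable M (\<lambda>\<omega>. K i j x (Z \<omega>) * g (Z \<omega>)) \<and>
     integrable M (\<lambda>\<omega>. K i (j + 1) x (Z \<omega>) * deriv g (Z \<omega>)) \<and>
     expectation (\<lambda>\<omega>. K i j x (Z \<omega>) * g (Z \<omega>))
       = expectation (\<lambda>\<omega>. K i (j + 1) x (Z \<omega>) * deriv g (Z \<omega>)) + MM i (int j) x * g x)"

definition kernel_diff :: "nat \<Rightarrow> nat \<Rightarrow> (real \<Rightarrow> real) \<Rightarrow> bool" where
  "kernel_diff i j g \<longleftrightarrow> (\<forall>x\<in>supp.
     integrable M (\<lambda>\<omega>. K i j x (Z \<omega>) * g (Z \<omega>)) \<and>
     integrable M (\<lambda>\<omega>. K (i + 1) j x (Z \<omega>) * g (Z \<omega>)) \<and>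
     ((\<lambda>y. expectation (\<lambda>\<omega>. K i j y (Z \<omega>) * g (Z \<omega>))) has_real_derivative
       expectation (\<lambda>\<omega>. K (i + 1) j x (Z \<omega>) * g (Z \<omega>)) - MM i (int j - 1) x * g x) (at x))"

text \<open>
  Starting from \<open>E[K\<^sup>0\<^sup>,\<^sup>0 h]\<close>, one alternates differentiation at \<open>(k, k)\<close> and integration by parts
  at \<open>(k + 1, k)\<close>, both applied to the \<open>k\<close>-th derivative of \<open>h\<close>. The representation through
  \<open>K\<^sup>n\<^sup>,\<^sup>n\<^sup>-\<^sup>1\<close> ends with the differentiation at \<open>(n - 1, n - 1)\<close>, the one through \<open>K\<^sup>n\<^sup>,\<^sup>n\<close> with the
  integration by parts at \<open>(n, n - 1)\<close>, and the one through \<open>K\<^sup>n\<^sup>,\<^sup>n\<^sup>+\<^sup>1\<close> with that at \<open>(n, n)\<close>.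
\<close>

definition regular :: "nat \<Rightarrow> (real \<Rightarrow> real) \<Rightarrow> bool" where
  "regular n h \<longleftrightarrow>
     integrable (density lborel (\<lambda>x. ennreal (p x))) h \<and>
     times_differentiable_on (n - 1) h supp \<and>
     (\<forall>r\<in>{1..m}. locally_abs_cont_on ((deriv ^^ (n - 1)) h) (einterval (e (r - 1)) (e r))) \<and>
     (\<forall>k<n. kernel_diff k k ((deriv ^^ k) h)) \<and>
     (\<forall>k. k + 1 < n \<longrightarrow> kernel_parts (k + 1) k ((deriv ^^ k) h))"

definition regular_n :: "nat \<Rightarrow> (real \<Rightarrow> real) \<Rightarrow> bool" where
  "regular_n n h \<longleftrightarrow> regular n h \<and> kernel_parts n (n - 1) ((deriv ^^ (n - 1)) h)"

definition regular_Suc_n :: "nat \<Rightarrow> (real \<Rightarrow> real) \<Rightarrow> bool" where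
  "regular_Suc_n n h \<longleftrightarrow> regular_n n h \<and>
     times_differentiable_on n h supp \<and>
     (\<forall>r\<in>{1..m}. locally_abs_cont_on ((deriv ^^ n) h) (einterval (e (r - 1)) (e r))) \<and>
     kernel_parts n n ((deriv ^^ n) h)"

end

end

theory Submission
  imports Defs
begin

text \<open>
  Write \<open>T(x) = E[(\<mu> - Z) 1{Z \<le> x}]\<close>, so that \<open>T = \<tau> p\<close> on the support. By Fubini, the iterated
  tails \<open>P\<^sub>k\<close> satisfy \<open>\<tau> P\<^sub>k - (k \<tau>' + \<mu> - x) P\<^sub>k\<^sub>+\<^sub>1 = q\<^sub>k\<^sub>+\<^sub>1 P\<^sub>k\<^sub>+\<^sub>2\<close>; a truncated version of the same
  identity yields the moments of order \<open>n\<close> from admissibility. Hence the derivatives of \<open>P / T\<close> are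
  \<open>q\<^sub>1 \<cdots> q\<^sub>k P\<^sub>k\<^sub>+\<^sub>1 / (\<tau>\<^sup>k T)\<close>, and likewise for the upper tails by the reflection \<open>x \<mapsto> -x\<close>. The
  recurrences make the lower-upper Wronskians telescope, so expanding \<open>(\<phi> P / T)\<^sup>(\<^sup>k\<^sup>)\<close> for
  \<open>\<phi> = \<tau> / w\<close> with \<open>\<phi>'' = c\<close> by Leibniz' rule gives
  \<open>M\<^sup>k\<^sup>,\<^sup>k\<^sup>-\<^sup>1 = -1 / w - (k choose 2) c / q\<^sub>k\<^sub>-\<^sub>1\<close>. The constants cancel along the alternation of
  differentiation and integration by parts, leaving
  \<open>f\<^sup>(\<^sup>k\<^sup>+\<^sup>1\<^sup>) = E[K\<^sup>k\<^sup>+\<^sup>1\<^sup>,\<^sup>k h\<^sup>(\<^sup>k\<^sup>)] + h\<^sup>(\<^sup>k\<^sup>) / w\<close> for every \<open>k < n\<close>.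
\<close>

subsection \<open>Integration on the real line\<close>

text \<open>As \<open>k\<close> is nonnegative, \<open>C s\<close> is also the L1 norm of
  \<open>k s\<close>. Integrability of \<open>\<lambda>s. g s * C s\<close> therefore gives
  integrability on the product, even when \<open>g\<close> changes sign.\<close>

lemma Fubini_kernel:
  fixes g C :: "real \<Rightarrow> real" and k :: "real \<Rightarrow> real \<Rightarrow> real"
  assumes g [measurable]: "g \<in> borel_measurable borel"
    and k [measurable]: "case_prod k \<in> borel_measurable (borel \<Otimes>\<^sub>M borel)"
    and nonneg: "\<And>s t. 0 \<le> k s t"
    and C: "\<And>s. has_bochner_integral lborel (k s) (C s)"
    and int: "integrable lborel (\<lambda>s. g s * C s)"
  shows "integrable lborel (\<lambda>t. LBINT s. g s * k s t)"
    and "(LBINT t. LBINT s. g s * k s t) = (LBINT s. g s * C s)"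
proof -
  have C_eq: "integral\<^sup>L lborel (k s) = C s" and k_int: "integrable lborel (k s)" for s
    using C[of s] by (auto simp: has_bochner_integral_iff)
  have C_nonneg: "0 \<le> C s" for s
    unfolding C_eq[symmetric] using nonneg by simp
  have *: "integrable (lborel \<Otimes>\<^sub>M lborel) (\<lambda>(s, t). g s * k s t)"
  proof (rule lborel_pair.Fubini_integrable)
    show "(\<lambda>(s, t). g s * k s t) \<in> borel_measurable (lborel \<Otimes>\<^sub>M lborel)"
      by measurable
    have "(\<lambda>s. LBINT t. norm (case (s, t) of (s, t) \<Rightarrow> g s * k s t)) = (\<lambda>s. \<bar>g s * C s\<bar>)"
      using nonneg C_nonneg by (auto simp: abs_mult C_eq)
    then show "integrable lborel (\<lambda>s. LBINT t. norm (case (s, t) of (s, t) \<Rightarrow> g s * k s t))"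
      using int by simp
    show "AE s in lborel. integrable lborel (\<lambda>t. case (s, t) of (s, t) \<Rightarrow> g s * k s t)"
      using k_int by simp
  qed
  show "integrable lborel (\<lambda>t. LBINT s. g s * k s t)"
    using lborel_pair.integrable_snd[OF *] .
  have "(LBINT t. LBINT s. g s * k s t) = (LBINT s. LBINT t. g s * k s t)"
    using lborel_pair.Fubini_integral[OF *] .
  then show "(LBINT t. LBINT s. g s * k s t) = (LBINT s. g s * C s)"
    by (simp add: C_eq)
qed

lemma has_bochner_integral_power_lower:
  fixes a x :: real
  assumes "a \<le> x"
  shows "has_bochner_integral lborel (\<lambda>t. indicator {a..x} t * (t - a) ^ k)
    ((x - a) ^ Suc k / real (Suc k))"
proof -
  have "has_bochner_integral lborel (\<lambda>t. (t - a) ^ k * indicator {a..x} t)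
      ((x - a) ^ Suc k / real (Suc k) - (a - a) ^ Suc k / real (Suc k))"
    using assms
    by (intro has_bochner_integral_FTC_Icc_nonneg)
       (auto intro!: derivative_eq_intros simp del: of_nat_Suc power_Suc)
  then show ?thesis
    by (simp add: mult.commute)
qed

lemma has_bochner_integral_power_upper:
  fixes a x :: real
  assumes "a \<le> x"
  shows "has_bochner_integral lborel (\<lambda>t. indicator {a..x} t * (real (Suc k) * (x - t) ^ k))
    ((x - a) ^ Suc k)"
proof -
  have "has_bochner_integral lborel (\<lambda>t. (real (Suc k) * (x - t) ^ k) * indicator {a..x} t)
      (- ((x - x) ^ Suc k) - (- ((x - a) ^ Suc k)))"
    using assms
    by (intro has_bochner_integral_FTC_Icc_nonneg)
       (auto intro!: derivative_eq_intros simp del: of_nat_Suc power_Suc)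
  then show ?thesis
    by (simp add: mult.commute)
qed

text \<open>Monotone convergence along the cut-offs at \<open>- n\<close>. It serves to produce a
  moment whose existence is not known beforehand.\<close>

lemma integrable_lower_truncations:
  fixes f :: "real \<Rightarrow> real"
  assumes [measurable]: "f \<in> borel_measurable borel" and nonneg: "\<And>x. 0 \<le> f x"
    and int: "\<And>a. integrable lborel (\<lambda>x. indicator {a..} x * f x)"
    and bound: "\<And>a. (LBINT x. indicator {a..} x * f x) \<le> C"
  shows "integrable lborel f"
proof -
  define g where "g n x = indicator {- real n..} x * f x" for n x
  have mono: "mono (\<lambda>n. g n x)" for x
    using nonneg by (auto simp: g_def mono_def indicator_def)
  have "incseq (\<lambda>n. LBINT x. g n x)"
    using mono int by (auto simp: incseq_def mono_def g_def intro!: integral_mono)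
  moreover have "(LBINT x. g n x) \<le> C" for n
    using bound by (simp add: g_def)
  ultimately obtain L where L: "(\<lambda>n. LBINT x. g n x) \<longlonglongrightarrow> L"
    using incseq_convergent by blast
  have lim: "(\<lambda>n. g n x) \<longlonglongrightarrow> f x" for x
  proof (rule tendsto_eventually, rule eventually_sequentiallyI[of "nat \<lceil>- x\<rceil>"])
    fix n assume "nat \<lceil>- x\<rceil> \<le> n"
    then have "- real n \<le> x" by linarith
    then show "g n x = f x" by (simp add: g_def)
  qed
  show ?thesis
    by (rule integral_monotone_convergence_nonneg[where f=g and x=L])
       (use int mono lim L nonneg in \<open>auto simp: g_def[abs_def]\<close>)
qed

text \<open>The fundamental theorem of calculus on a small interval \<open>{a..b}\<close> around
  \<open>x\<close> inside \<open>S\<close>; the integral up to \<open>a\<close> is only an additive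
  constant.\<close>

lemma DERIV_lower_integral:
  fixes f :: "real \<Rightarrow> real"
  assumes int: "\<And>x. integrable lborel (\<lambda>t. indicator {..x} t * f t)"
    and S: "open S" "x \<in> S" and cont: "continuous_on S f"
  shows "((\<lambda>x. LBINT t. indicator {..x} t * f t) has_real_derivative f x) (at x)"
proof -
  obtain d where d: "0 < d" "ball x d \<subseteq> S"
    using S open_contains_ball by blast
  define a b where "a = x - d / 2" and "b = x + d / 2"
  have ab: "a < x" "x < b" "{a..b} \<subseteq> S"
    using d by (auto simp: a_def b_def dist_real_def subset_iff)
  have "((\<lambda>u. LBINT y=a..u. f y) has_vector_derivative f x) (at x within {a..b})"
    using ab by (intro interval_integral_FTC2) (auto intro: continuous_on_subset[OF cont])
  then have "((\<lambda>u. LBINT y=a..u. f y) has_real_derivative f x) (at x)"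
    using ab by (simp add: at_within_Icc_at has_real_derivative_iff_has_vector_derivative)
  from DERIV_add[OF DERIV_const this]
  have D: "((\<lambda>u. (LBINT t. indicator {..a} t * f t) + (LBINT y=a..u. f y))
      has_real_derivative f x) (at x)"
    by simp
  have eq: "(LBINT t. indicator {..a} t * f t) + (LBINT y=a..u. f y)
      = (LBINT t. indicator {..u} t * f t)" if u: "u \<in> {a<..<b}" for u
  proof -
    have eq: "indicator {..u} t * f t - indicator {..a} t * f t = indicator {a<..u} t * f t" for t
      using u by (simp add: indicator_def)
    have "(LBINT y=a..u. f y) = (LBINT t. indicator {..u} t * f t - indicator {..a} t * f t)"
      using u by (simp add: interval_integral_Ioc set_lebesgue_integral_def eq)
    then show ?thesis
      by (simp add: Bochner_Integration.integral_diff[OF int int])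
  qed
  show ?thesis
    by (rule has_field_derivative_transform_within_open[OF D, of "{a<..<b}"])
       (use ab eq in auto)
qed

subsection \<open>Iterated tail integrals\<close>

text \<open>Cauchy's formula for repeated integration: the \<open>(k + 1)\<close>-fold integral of
  \<open>p\<close> from the left, with the distribution function at \<open>k = 0\<close>.\<close>

definition lower_tail :: "(real \<Rightarrow> real) \<Rightarrow> nat \<Rightarrow> real \<Rightarrow> real" where
  "lower_tail p k x = (LBINT s. indicator {..x} s * ((x - s) ^ k * p s)) / fact k"

text \<open>Explicitly, the integral of \<open>(s - x) ^ k * p s\<close> over
  \<open>s \<ge> x\<close>, divided by \<open>fact k\<close>. The reflected form lets upper-tail
  facts be read off the lower ones for \<open>\<lambda>s. p (- s)\<close>.\<close>

definition upper_tail :: "(real \<Rightarrow> real) \<Rightarrow> nat \<Rightarrow> real \<Rightarrow> real" where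
  "upper_tail p k x = lower_tail (\<lambda>s. p (- s)) k (- x)"

locale real_density =
  fixes p :: "real \<Rightarrow> real"
  assumes nonneg: "\<And>x. 0 \<le> p x"
    and prob: "has_bochner_integral lborel p 1"
begin

lemma measurable_p [measurable]: "p \<in> borel_measurable borel"
  using prob by (auto dest: has_bochner_integral_iff[THEN iffD1])

lemma integrable_p: "integrable lborel p"
  using prob by (auto dest: has_bochner_integral_iff[THEN iffD1])

definition moment :: "nat \<Rightarrow> bool" where
  "moment k \<longleftrightarrow> integrable lborel (\<lambda>t. \<bar>t\<bar> ^ k * p t)"

lemma moment_0: "moment 0"
  using integrable_p by (simp add: moment_def)

lemma moment_shift:
  assumes "moment k" and [measurable]: "A \<in> sets borel"
  shows "integrable lborel (\<lambda>s. indicator A s * ((x - s) ^ k * p s))"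
proof (rule Bochner_Integration.integrable_bound)
  show "integrable lborel (\<lambda>s. (2 ^ k * \<bar>x\<bar> ^ k) * p s + 2 ^ k * (\<bar>s\<bar> ^ k * p s))"
    using assms integrable_p unfolding moment_def by auto
  have bound: "\<bar>x - s\<bar> ^ k \<le> 2 ^ k * \<bar>x\<bar> ^ k + 2 ^ k * \<bar>s\<bar> ^ k" for s
  proof -
    have "\<bar>x - s\<bar> ^ k \<le> (2 * max \<bar>x\<bar> \<bar>s\<bar>) ^ k"
      by (intro power_mono) auto
    also have "\<dots> \<le> 2 ^ k * \<bar>x\<bar> ^ k + 2 ^ k * \<bar>s\<bar> ^ k"
      by (simp add: max_def power_mult_distrib)
    finally show ?thesis .
  qed
  have "indicator A s * \<bar>x - s\<bar> ^ k * p s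
      \<le> 2 ^ k * \<bar>x\<bar> ^ k * p s + 2 ^ k * (\<bar>s\<bar> ^ k * p s)" for s
    using mult_right_mono[OF bound[of s] nonneg[of s]] nonneg[of s]
    by (auto simp: algebra_simps indicator_def)
  then show "AE s in lborel. norm (indicator A s * ((x - s) ^ k * p s))
      \<le> norm ((2 ^ k * \<bar>x\<bar> ^ k) * p s + 2 ^ k * (\<bar>s\<bar> ^ k * p s))"
    using nonneg by (auto simp: abs_mult power_abs mult.assoc intro!: AE_I2)
qed measurable

lemma moment_antimono:
  assumes "moment k" "j \<le> k"
  shows "moment j"
  unfolding moment_def
proof (rule Bochner_Integration.integrable_bound)
  show "integrable lborel (\<lambda>s. p s + \<bar>s\<bar> ^ k * p s)"
    using assms integrable_p unfolding moment_def by auto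
  have bound: "\<bar>s\<bar> ^ j \<le> 1 + \<bar>s\<bar> ^ k" for s :: real
  proof (cases "\<bar>s\<bar> \<le> 1")
    case True
    then show ?thesis by (smt (verit) power_le_one zero_le_power abs_ge_zero)
  next
    case False
    then have "\<bar>s\<bar> ^ j \<le> \<bar>s\<bar> ^ k"
      using assms(2) by (intro power_increasing) auto
    then show ?thesis by linarith
  qed
  show "AE s in lborel. norm (\<bar>s\<bar> ^ j * p s) \<le> norm (p s + \<bar>s\<bar> ^ k * p s)"
    using mult_right_mono[OF bound nonneg] nonneg
    by (auto simp: abs_mult algebra_simps intro!: AE_I2)
qed measurable

text \<open>Exchange the integrals: integrating \<open>(t - s) ^ k\<close> over
  \<open>{s..x}\<close> produces the next power of \<open>x - s\<close>.\<close>

lemma lower_tail_Suc: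
  assumes "moment (Suc k)"
  shows "integrable lborel (\<lambda>t. indicator {..x} t * lower_tail p k t)"
    and "lower_tail p (Suc k) x = (LBINT t. indicator {..x} t * lower_tail p k t)"
proof -
  let ?k = "\<lambda>s t. indicator {s..x} t * (t - s) ^ k"
  let ?C = "\<lambda>s. indicator {..x} s * ((x - s) ^ Suc k / real (Suc k))"
  have C: "has_bochner_integral lborel (?k s) (?C s)" for s
    using has_bochner_integral_power_lower[of s x k] by (cases "s \<le> x") auto
  have int: "integrable lborel (\<lambda>s. p s * ?C s)"
    using integrable_divide[OF moment_shift[OF assms, of "{..x}" x], of "real (Suc k)"]
    by (simp add: mult_ac)
  have inner: "(LBINT s. p s * ?k s t) = fact k * (indicator {..x} t * lower_tail p k t)" for t
    by (auto simp: lower_tail_def indicator_def mult_ac intro!: Bochner_Integration.integral_cong)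
  have "?k s t \<ge> 0" for s t
    by (auto simp: indicator_def)
  note F = Fubini_kernel[OF measurable_p _ this C int, unfolded inner]
  have m: "case_prod ?k \<in> borel_measurable (borel \<Otimes>\<^sub>M borel)"
    unfolding indicator_def atLeastAtMost_iff by measurable
  show "integrable lborel (\<lambda>t. indicator {..x} t * lower_tail p k t)"
    using F(1)[OF m] by simp
  have "fact k * (LBINT t. indicator {..x} t * lower_tail p k t) = (LBINT s. p s * ?C s)"
    using F(2)[OF m] by simp
  also have "\<dots> = (LBINT s. indicator {..x} s * ((x - s) ^ Suc k * p s) / real (Suc k))"
    by (intro Bochner_Integration.integral_cong) simp_all
  also have "\<dots> = fact k * lower_tail p (Suc k) x"
    by (simp add: lower_tail_def del: power_Suc of_nat_Suc)
  finally show "lower_tail p (Suc k) x = (LBINT t. indicator {..x} t * lower_tail p k t)"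
    by simp
qed

lemma reflect: "real_density (\<lambda>x. p (- x))"
proof
  show "has_bochner_integral lborel (\<lambda>x. p (- x)) 1"
    using prob lborel_has_bochner_integral_real_affine_iff[of "-1" p 1 0] by simp
qed (rule nonneg)

lemma moment_reflect: "real_density.moment (\<lambda>x. p (- x)) k \<longleftrightarrow> moment k"
proof -
  interpret r: real_density "\<lambda>x. p (- x)" by (rule reflect)
  show ?thesis
    using lborel_integrable_real_affine_iff[of "-1" "\<lambda>t. \<bar>t\<bar> ^ k * p t" 0]
    by (simp add: moment_def r.moment_def)
qed

text \<open>After reflection the two tails are integrals over half-lines that share only the null
  set \<open>{x}\<close>.\<close>

lemma tails_sum: "lower_tail p 0 x + upper_tail p 0 x = 1"
proof -
  have "upper_tail p 0 x = (LBINT s. indicator {x..} s * p s)"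
    unfolding upper_tail_def lower_tail_def
    by (subst lborel_integral_real_affine[of "-1" _ 0])
       (auto simp: indicator_def intro!: Bochner_Integration.integral_cong)
  also have "\<dots> = (LBINT s. p s - indicator {..x} s * p s)"
    by (rule integral_cong_AE) (use AE_lborel_singleton[of x] in \<open>auto simp: indicator_def\<close>)
  also have "\<dots> = 1 - lower_tail p 0 x"
    using prob moment_shift[OF moment_0, of "{..x}"]
    by (subst Bochner_Integration.integral_diff)
       (auto simp: lower_tail_def has_bochner_integral_iff)
  finally show ?thesis by simp
qed

end

subsection \<open>Moments and the Stein identity\<close>

text \<open>The Stein kernel relation is multiplied by \<open>p\<close> so that it makes sense on
  the whole line, and it is required almost everywhere: at an interior breakpoint \<open>p\<close>
  is zero while the right-hand side may be positive.\<close>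

locale pearson_density = real_density +
  fixes \<mu> \<kappa>2 \<kappa>1 \<kappa>0 :: real
  assumes mean: "has_bochner_integral lborel (\<lambda>t. t * p t) \<mu>"
    and kernel: "AE t in lborel. (\<kappa>2 * t\<^sup>2 + \<kappa>1 * t + \<kappa>0) * p t
      = (LBINT s. indicator {..t} s * ((\<mu> - s) * p s))"
begin

definition \<tau> :: "real \<Rightarrow> real" where
  "\<tau> t = \<kappa>2 * t\<^sup>2 + \<kappa>1 * t + \<kappa>0"

definition \<tau>' :: "real \<Rightarrow> real" where
  "\<tau>' t = 2 * \<kappa>2 * t + \<kappa>1"

definition T :: "real \<Rightarrow> real" where
  "T t = (LBINT s. indicator {..t} s * ((\<mu> - s) * p s))"

text \<open>The exact Taylor expansion of a quadratic at \<open>x\<close>. It turns an integral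
  weighted by \<open>\<tau>\<close> into three consecutive moments about \<open>x\<close>.\<close>

lemma \<tau>_expand: "\<tau> t = \<tau> x - \<tau>' x * (x - t) + \<kappa>2 * (x - t)\<^sup>2"
  by (simp add: \<tau>_def \<tau>'_def power2_eq_square algebra_simps)

lemma \<tau>_weight_expand:
  "i * ((x - t) ^ k * (\<tau> t * q)) = \<tau> x * (i * ((x - t) ^ k * q))
    - \<tau>' x * (i * ((x - t) ^ Suc k * q)) + \<kappa>2 * (i * ((x - t) ^ Suc (Suc k) * q))"
  unfolding \<tau>_expand[of t x] by (simp add: algebra_simps power2_eq_square)

lemma measurable_\<tau> [measurable]: "\<tau> \<in> borel_measurable borel"
  unfolding \<tau>_def by measurable

lemma integrable_mean: "integrable lborel (\<lambda>t. t * p t)"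
  using mean by (auto dest: has_bochner_integral_iff[THEN iffD1])

lemma moment_1: "moment (Suc 0)"
  using integrable_abs[OF integrable_mean] nonneg by (simp add: moment_def abs_mult)

lemma integrable_centred: "integrable lborel (\<lambda>s. indicator {..t} s * ((\<mu> - s) * p s))"
  using moment_shift[OF moment_1, of "{..t}" \<mu>] by simp

lemma T_eq_tails: "T x = (\<mu> - x) * lower_tail p 0 x + lower_tail p 1 x"
proof -
  have "T x = (LBINT s. (\<mu> - x) * (indicator {..x} s * p s) + indicator {..x} s * ((x - s) * p s))"
    unfolding T_def by (rule Bochner_Integration.integral_cong) (auto simp: algebra_simps)
  also have "\<dots> = (\<mu> - x) * (LBINT s. indicator {..x} s * p s) + (LBINT s. indicator {..x} s * ((x - s) * p s))"
    using moment_shift[OF moment_0, of "{..x}"] moment_shift[OF moment_1, of "{..x}" x]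
    by (subst Bochner_Integration.integral_add) simp_all
  finally show ?thesis
    by (simp add: lower_tail_def)
qed

text \<open>The cut-off \<open>b\<close> is \<open>s\<close> for the Stein identity, and \<open>max s a\<close> where moments are not yet known.\<close>

lemma stein_identity_cut:
  fixes b :: "real \<Rightarrow> real"
  assumes [measurable]: "b \<in> borel_measurable borel" and le: "\<And>s. s \<le> b s"
    and int: "integrable lborel (\<lambda>s. indicator {..x} (b s) * ((x - b s) ^ Suc k * ((\<mu> - s) * p s)))"
    and [measurable]: "A \<in> sets borel"
    and A: "\<And>s t. indicator {b s..x} t = indicator A t * (indicator {..t} s :: real)"
  shows "integrable lborel (\<lambda>t. indicator A t * ((x - t) ^ k * (\<tau> t * p t)))"
    and "real (Suc k) * (LBINT t. indicator A t * ((x - t) ^ k * (\<tau> t * p t)))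
      = (LBINT s. indicator {..x} (b s) * ((x - b s) ^ Suc k * ((\<mu> - s) * p s)))"
proof -
  let ?k = "\<lambda>s t. indicator {b s..x} t * (real (Suc k) * (x - t) ^ k)"
  let ?C = "\<lambda>s. indicator {..x} (b s) * (x - b s) ^ Suc k"
  let ?g = "\<lambda>s. (\<mu> - s) * p s"
  have C: "has_bochner_integral lborel (?k s) (?C s)" for s
    using has_bochner_integral_power_upper[of "b s" x k]
    by (cases "b s \<le> x") (auto simp: field_simps)
  have int': "integrable lborel (\<lambda>s. ?g s * ?C s)"
    using int by (simp add: mult_ac)
  have g: "?g \<in> borel_measurable borel" by measurable
  have nn: "?k s t \<ge> 0" for s t
    by (auto simp: indicator_def)
  \<comment> \<open>The factor \<open>indicator {..t} s\<close> split off by \<open>A\<close> makes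
    the inner integral equal to \<open>T t\<close>.\<close>
  have inner: "(LBINT s. ?g s * ?k s t) = indicator A t * (real (Suc k) * (x - t) ^ k * T t)" for t
    unfolding A T_def by (simp add: mult_ac flip: integral_mult_right_zero)
  have m: "case_prod ?k \<in> borel_measurable (borel \<Otimes>\<^sub>M borel)"
    unfolding indicator_def atLeastAtMost_iff by measurable
  note F = Fubini_kernel[OF g m nn C int', unfolded inner]
  \<comment> \<open>The kernel relation enters here, replacing \<open>T t\<close> by
    \<open>\<tau> t * p t\<close> for almost every \<open>t\<close>.\<close>
  have AE: "AE t in lborel. indicator A t * (real (Suc k) * (x - t) ^ k * T t)
      = real (Suc k) * (indicator A t * ((x - t) ^ k * (\<tau> t * p t)))"
    using kernel by eventually_elim (simp add: T_def \<tau>_def)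
  have meas: "(\<lambda>t. real (Suc k) * (indicator A t * ((x - t) ^ k * (\<tau> t * p t)))) \<in> borel_measurable lborel"
    by measurable
  have "integrable lborel (\<lambda>t. real (Suc k) * (indicator A t * ((x - t) ^ k * (\<tau> t * p t))))"
    by (rule integrable_cong_AE_imp[OF F(1) meas AE])
  then show "integrable lborel (\<lambda>t. indicator A t * ((x - t) ^ k * (\<tau> t * p t)))"
    by (simp del: of_nat_Suc)
  have "(LBINT t. real (Suc k) * (indicator A t * ((x - t) ^ k * (\<tau> t * p t)))) 
     = (LBINT t. indicator A t * (real (Suc k) * (x - t) ^ k * T t))"
    by (rule integral_cong_AE[OF meas borel_measurable_integrable[OF F(1)] AE[THEN AE_symmetric]])
  then show "real (Suc k) * (LBINT t. indicator A t * ((x - t) ^ k * (\<tau> t * p t)))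
      = (LBINT s. indicator {..x} (b s) * ((x - b s) ^ Suc k * ((\<mu> - s) * p s)))"
    using F(2) unfolding integral_mult_right_zero by (simp only: mult_ac)
qed

text \<open>Truncate at \<open>a\<close> and use the cut identity at \<open>x = \<mu>\<close> with
  cut-off \<open>max s a\<close>. After expanding \<open>\<tau>\<close> at \<mu>, the truncated
  moment of order \<open>k + 2\<close> is bounded by known moments plus
  \<open>Suc k * \<kappa>2\<close> times itself. Since that factor is below 1, the term can be
  absorbed, and the bound is uniform in \<open>a\<close>.\<close>

lemma moment_Suc_lower:
  assumes mom: "moment (Suc k)" and adm: "real (Suc k) * \<kappa>2 < 1"
  shows "integrable lborel (\<lambda>s. indicator {..\<mu>} s * ((\<mu> - s) ^ Suc (Suc k) * p s))"
proof (rule integrable_lower_truncations)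
  let ?I = "\<lambda>a j. LBINT s. indicator {a..\<mu>} s * ((\<mu> - s) ^ j * p s)"
  let ?M = "\<lambda>j. LBINT s. indicator {..\<mu>} s * ((\<mu> - s) ^ j * p s)"
  have eq: "indicator {a..} s * (indicator {..\<mu>} s * ((\<mu> - s) ^ j * p s))
      = indicator {a..\<mu>} s * ((\<mu> - s) ^ j * p s)" for a s j
    by (auto simp: indicator_def)
  have int_top: "integrable lborel (\<lambda>s. indicator {a..\<mu>} s * ((\<mu> - s) ^ j * p s))" for a j
  proof (rule Bochner_Integration.integrable_bound[OF integrable_mult_right[OF integrable_p, of "\<bar>\<mu> - a\<bar> ^ j"]])
    show "AE s in lborel. norm (indicator {a..\<mu>} s * ((\<mu> - s) ^ j * p s)) \<le> norm (\<bar>\<mu> - a\<bar> ^ j * p s)"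
      using nonneg by (auto simp: indicator_def abs_mult intro!: AE_I2 mult_right_mono power_mono)
  qed measurable
  show "integrable lborel (\<lambda>s. indicator {a..} s * (indicator {..\<mu>} s * ((\<mu> - s) ^ Suc (Suc k) * p s)))" for a
    unfolding eq by (rule int_top)
  show "(LBINT s. indicator {a..} s * (indicator {..\<mu>} s * ((\<mu> - s) ^ Suc (Suc k) * p s)))
      \<le> real (Suc k) * (\<bar>\<tau> \<mu>\<bar> * ?M k + \<bar>\<tau>' \<mu>\<bar> * ?M (Suc k)) / (1 - real (Suc k) * \<kappa>2)" for a
  proof -
    let ?C = "\<lambda>s. indicator {..\<mu>} (max s a) * ((\<mu> - max s a) ^ Suc k * ((\<mu> - s) * p s))"
    have C_int: "integrable lborel ?C"
    proof (rule Bochner_Integration.integrable_bound)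
      show "integrable lborel (\<lambda>s. \<bar>\<mu> - a\<bar> ^ Suc k * \<bar>indicator UNIV s * ((\<mu> - s) ^ 1 * p s)\<bar>)"
        using moment_shift[OF moment_1, of UNIV \<mu>] by (intro integrable_mult_right integrable_abs) simp_all
      show "AE s in lborel. norm (?C s) \<le> norm (\<bar>\<mu> - a\<bar> ^ Suc k * \<bar>indicator UNIV s * ((\<mu> - s) ^ 1 * p s)\<bar>)"
        using nonneg
        by (auto simp: indicator_def abs_mult power_abs simp del: power_Suc intro!: AE_I2 mult_right_mono power_mono)
    qed measurable
    \<comment> \<open>For \<open>s < a\<close> the right-hand side is still nonnegative, since
      \<open>max s a \<le> \<mu>\<close> forces \<open>s \<le> \<mu>\<close>; for
      \<open>s \<ge> a\<close> both sides agree.\<close>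
    have C_ge: "indicator {a..\<mu>} s * ((\<mu> - s) ^ Suc (Suc k) * p s) \<le> ?C s" for s
      using nonneg[of s] by (auto simp: indicator_def max_def mult_ac)
    have ind: "indicator {max s a..\<mu>} t = indicator {a..\<mu>} t * (indicator {..t} s :: real)" for s t
      by (auto simp: indicator_def)
    have "(\<lambda>s. max s a) \<in> borel_measurable borel" by measurable
    note S = stein_identity_cut[OF this _ C_int _ ind]
    have "(LBINT t. indicator {a..\<mu>} t * ((\<mu> - t) ^ k * (\<tau> t * p t)))
       = (LBINT t. \<tau> \<mu> * (indicator {a..\<mu>} t * ((\<mu> - t) ^ k * p t))
            - \<tau>' \<mu> * (indicator {a..\<mu>} t * ((\<mu> - t) ^ Suc k * p t))
            + \<kappa>2 * (indicator {a..\<mu>} t * ((\<mu> - t) ^ Suc (Suc k) * p t)))"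
      by (simp only: \<tau>_weight_expand)
    also have "\<dots> = \<tau> \<mu> * ?I a k - \<tau>' \<mu> * ?I a (Suc k) + \<kappa>2 * ?I a (Suc (Suc k))"
      using int_top by (simp del: power_Suc)
    finally have 1: "?I a (Suc (Suc k))
        \<le> real (Suc k) * (\<tau> \<mu> * ?I a k - \<tau>' \<mu> * ?I a (Suc k) + \<kappa>2 * ?I a (Suc (Suc k)))"
      using integral_mono[OF int_top C_int C_ge] S(2) by simp
    have I: "0 \<le> ?I a j" "?I a j \<le> ?M j" if "moment j" for j
      using nonneg moment_shift[OF that, of "{..\<mu>}" \<mu>] int_top
      by (auto intro!: integral_mono Bochner_Integration.integral_nonneg simp: indicator_def)
    have mk: "moment k" using mom by (rule moment_antimono) simp
    have "\<tau> \<mu> * ?I a k \<le> \<bar>\<tau> \<mu>\<bar> * ?M k" "- \<tau>' \<mu> * ?I a (Suc k) \<le> \<bar>\<tau>' \<mu>\<bar> * ?M (Suc k)"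
      by (rule mult_mono; use I[OF mk] I[OF mom] in simp)+
    then have "real (Suc k) * (\<tau> \<mu> * ?I a k + (- \<tau>' \<mu> * ?I a (Suc k)))
       \<le> real (Suc k) * (\<bar>\<tau> \<mu>\<bar> * ?M k + \<bar>\<tau>' \<mu>\<bar> * ?M (Suc k))"
      by (intro mult_left_mono add_mono) auto
    with 1 have "(1 - real (Suc k) * \<kappa>2) * ?I a (Suc (Suc k))
       \<le> real (Suc k) * (\<bar>\<tau> \<mu>\<bar> * ?M k + \<bar>\<tau>' \<mu>\<bar> * ?M (Suc k))"
      by (simp add: algebra_simps del: power_Suc of_nat_Suc)
    then show ?thesis
      unfolding eq using adm by (simp add: pos_le_divide_eq mult.commute del: power_Suc of_nat_Suc)
  qed
qed (use nonneg in \<open>auto simp: indicator_def\<close>)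

text \<open>The total integral of \<open>(\<mu> - s) * p s\<close> is zero, so \<open>T\<close> can
  equally be computed from the upper side.\<close>

lemma T_reflect:
  "(LBINT s. indicator {..t} s * ((- \<mu> - s) * p (- s))) = T (- t)"
proof -
  have int: "integrable lborel (\<lambda>s. (\<mu> - s) * p s)"
    using moment_shift[OF moment_1, of UNIV \<mu>] by simp
  have 0: "(LBINT s. (\<mu> - s) * p s) = 0"
    using mean prob by (simp add: left_diff_distrib has_bochner_integral_iff)
  have "(LBINT s. indicator {..t} s * ((- \<mu> - s) * p (- s)))
      = (LBINT s. indicator {..t} (- s) * ((- \<mu> + s) * p s))"
    by (subst lborel_integral_real_affine[of "-1" _ 0]) simp_all
  also have "\<dots> = (LBINT s. indicator {..- t} s * ((\<mu> - s) * p s) - (\<mu> - s) * p s)"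
    by (rule integral_cong_AE)
       (use AE_lborel_singleton[of "- t"] in \<open>auto simp: indicator_def algebra_simps\<close>)
  also have "\<dots> = T (- t)"
    by (simp add: integrable_centred int 0 T_def)
  finally show ?thesis .
qed

lemma reflect_pearson: "pearson_density (\<lambda>x. p (- x)) (- \<mu>) \<kappa>2 (- \<kappa>1) \<kappa>0"
proof (intro pearson_density.intro reflect pearson_density_axioms.intro)
  show "has_bochner_integral lborel (\<lambda>t. t * p (- t)) (- \<mu>)"
    using lborel_has_bochner_integral_real_affine_iff[of "-1" "\<lambda>t. - t * p t" "-\<mu>" 0]
      has_bochner_integral_minus[OF mean] by simp
  have "AE t in lborel. (\<kappa>2 * (- t)\<^sup>2 + \<kappa>1 * (- t) + \<kappa>0) * p (- t) = T (- t)"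
  proof (rule AE_distrD[of uminus lborel borel])
    show "AE t in distr lborel borel uminus. (\<kappa>2 * t\<^sup>2 + \<kappa>1 * t + \<kappa>0) * p t = T t"
      using kernel unfolding lborel_distr_uminus T_def .
  qed simp
  then show "AE t in lborel. (\<kappa>2 * t\<^sup>2 + - \<kappa>1 * t + \<kappa>0) * p (- t)
      = (LBINT s. indicator {..t} s * ((- \<mu> - s) * p (- s)))"
    by (simp add: T_reflect)
qed

text \<open>The half-lines below and above the mean are treated separately, the upper one by
  reflection. Reflection keeps \<open>\<kappa>2\<close>, so the same condition applies to
  both.\<close>

lemma moment_Suc:
  assumes mom: "moment (Suc k)" and adm: "real (Suc k) * \<kappa>2 < 1"
  shows "moment (Suc (Suc k))"
proof -
  interpret r: pearson_density "\<lambda>x. p (- x)" "- \<mu>" \<kappa>2 "- \<kappa>1" \<kappa>0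
    by (rule reflect_pearson)
  have 1: "integrable lborel (\<lambda>s. indicator {..\<mu>} s * ((\<mu> - s) ^ Suc (Suc k) * p s))"
    by (rule moment_Suc_lower[OF mom adm])
  have "r.moment (Suc k)"
    using mom by (simp add: moment_reflect)
  from lborel_integrable_real_affine[OF r.moment_Suc_lower[OF this adm], of "-1" 0]
  have 2: "integrable lborel (\<lambda>s. indicator {..- \<mu>} (- s) * ((s - \<mu>) ^ Suc (Suc k) * p s))"
    by (simp del: power_Suc)
  have "integrable lborel (\<lambda>s. \<bar>\<mu>\<bar> ^ Suc (Suc k) * p s + (indicator {..\<mu>} s * ((\<mu> - s) ^ Suc (Suc k) * p s)
      + indicator {..- \<mu>} (- s) * ((s - \<mu>) ^ Suc (Suc k) * p s)))"
    using 1 2 integrable_p by (intro Bochner_Integration.integrable_add integrable_mult_right)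
  from integrable_mult_right[OF this, of "2 ^ Suc (Suc k)"]
  show ?thesis
    unfolding moment_def
  proof (rule Bochner_Integration.integrable_bound)
    have "\<bar>s\<bar> ^ j \<le> 2 ^ j * (\<bar>\<mu>\<bar> ^ j + \<bar>\<mu> - s\<bar> ^ j)" for s :: real and j
    proof -
      have "\<bar>s\<bar> ^ j \<le> (2 * max \<bar>\<mu>\<bar> \<bar>\<mu> - s\<bar>) ^ j"
        by (intro power_mono) (auto simp: max_def abs_if split: if_splits)
      also have "\<dots> \<le> 2 ^ j * (\<bar>\<mu>\<bar> ^ j + \<bar>\<mu> - s\<bar> ^ j)"
        by (simp add: max_def power_mult_distrib)
      finally show ?thesis .
    qed
    from mult_right_mono[OF this nonneg]
    have "\<bar>s\<bar> ^ j * p s \<le> 2 ^ j * (\<bar>\<mu>\<bar> ^ j * p s + \<bar>\<mu> - s\<bar> ^ j * p s)" for s j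
      by (simp add: algebra_simps)
    moreover have "\<bar>\<mu> - s\<bar> ^ j * p s \<le> indicator {..\<mu>} s * ((\<mu> - s) ^ j * p s)
        + indicator {..- \<mu>} (- s) * ((s - \<mu>) ^ j * p s)" for s j
      using nonneg[of s] by (auto simp: indicator_def abs_if)
    ultimately have "\<bar>s\<bar> ^ j * p s \<le> 2 ^ j * (\<bar>\<mu>\<bar> ^ j * p s + (indicator {..\<mu>} s * ((\<mu> - s) ^ j * p s)
        + indicator {..- \<mu>} (- s) * ((s - \<mu>) ^ j * p s)))" for s j
      by (smt (verit) mult_left_mono zero_le_power)
    then show "AE s in lborel. norm (\<bar>s\<bar> ^ Suc (Suc k) * p s) \<le> norm (2 ^ Suc (Suc k) *
       (\<bar>\<mu>\<bar> ^ Suc (Suc k) * p s + (indicator {..\<mu>} s * ((\<mu> - s) ^ Suc (Suc k) * p s)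
        + indicator {..- \<mu>} (- s) * ((s - \<mu>) ^ Suc (Suc k) * p s))))"
      using nonneg by (intro AE_I2) (smt (verit) real_norm_def zero_le_power mult_nonneg_nonneg)
  qed measurable
qed

text \<open>The first moment is the mean. From there on, positivity of
  \<open>pearson_q \<kappa>2 (Suc k)\<close> says \<open>k * \<kappa>2 < 1\<close>, which is what
  \<open>moment_Suc\<close> asks for to pass from order \<open>k\<close> to
  \<open>k + 1\<close>.\<close>

lemma moment_admissible:
  assumes "admissible \<kappa>2 k"
  shows "moment k"
  using assms
proof (induction k)
  case (Suc k)
  show ?case
  proof (cases k)
    case (Suc j)
    have "0 < pearson_q \<kappa>2 (Suc k)"
      using Suc.prems by (simp add: admissible_def)
    then have "real (Suc j) * \<kappa>2 < 1"
      by (simp add: pearson_q_def Suc zero_less_mult_iff)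
    moreover have "moment (Suc j)"
      using Suc.IH Suc.prems by (simp add: admissible_def Suc)
    ultimately show ?thesis
      unfolding Suc by (intro moment_Suc)
  qed (simp add: moment_1)
qed (simp add: moment_0)

text \<open>The Stein identity for the test function \<open>(x - s) ^ Suc k\<close> on
  \<open>s \<le> x\<close>, with \<open>\<tau>\<close> expanded at \<open>x\<close> and
  \<open>\<mu> - s\<close> split as \<open>(\<mu> - x) + (x - s)\<close>.\<close>

lemma lower_tail_recurrence:
  assumes mom: "moment (Suc (Suc k))"
  shows "\<tau> x * lower_tail p k x - (real (Suc k) * \<tau>' x + \<mu> - x) * lower_tail p (Suc k) x
    = pearson_q \<kappa>2 (Suc (Suc k)) * lower_tail p (Suc (Suc k)) x"
proof -
  let ?I = "\<lambda>j. LBINT s. indicator {..x} s * ((x - s) ^ j * p s)"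
  have int: "integrable lborel (\<lambda>s. indicator {..x} s * ((x - s) ^ j * p s))" if "j \<le> Suc (Suc k)" for j
    using moment_shift[OF moment_antimono[OF mom that]] by simp
  have split: "indicator {..x} s * ((x - s) ^ Suc k * ((\<mu> - s) * p s))
     = (\<mu> - x) * (indicator {..x} s * ((x - s) ^ Suc k * p s))
       + indicator {..x} s * ((x - s) ^ Suc (Suc k) * p s)" for s
    by (auto simp: algebra_simps)
  have int2: "integrable lborel (\<lambda>s. indicator {..x} s * ((x - s) ^ Suc k * ((\<mu> - s) * p s)))"
    unfolding split using int by (simp del: power_Suc)
  have ind: "indicator {s..x} t = indicator {..x} t * (indicator {..t} s :: real)" for s t
    by (auto simp: indicator_def)
  have "(\<lambda>s::real. s) \<in> borel_measurable borel" by simp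
  note S = stein_identity_cut[OF this order_refl int2 _ ind]
  have "(LBINT t. indicator {..x} t * ((x - t) ^ k * (\<tau> t * p t)))
       = (LBINT t. \<tau> x * (indicator {..x} t * ((x - t) ^ k * p t))
            - \<tau>' x * (indicator {..x} t * ((x - t) ^ Suc k * p t))
            + \<kappa>2 * (indicator {..x} t * ((x - t) ^ Suc (Suc k) * p t)))"
    by (simp only: \<tau>_weight_expand)
  also have "\<dots> = \<tau> x * ?I k - \<tau>' x * ?I (Suc k) + \<kappa>2 * ?I (Suc (Suc k))"
    using int by (simp del: power_Suc)
  finally have "real (Suc k) * (\<tau> x * ?I k - \<tau>' x * ?I (Suc k) + \<kappa>2 * ?I (Suc (Suc k)))
     = (\<mu> - x) * ?I (Suc k) + ?I (Suc (Suc k))"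
    using S(2) int unfolding split by (simp del: power_Suc of_nat_Suc)
  moreover have "?I j = fact j * lower_tail p j x" for j
    by (simp add: lower_tail_def)
  \<comment> \<open>In terms of tails, the moments of order \<open>k\<close>, \<open>k + 1\<close>,
    \<open>k + 2\<close> carry consecutive factorials. After division by \<open>fact (Suc k)\<close>
    the top coefficients combine to \<open>(k + 2) * (1 - (k + 1) * \<kappa>2)\<close>, which is
    \<open>q\<close> at \<open>k + 2\<close>.\<close>
  ultimately have "fact (Suc k) * (\<tau> x * lower_tail p k x - real (Suc k) * (\<tau>' x * lower_tail p (Suc k) x)
       + \<kappa>2 * real (Suc k) * real (Suc (Suc k)) * lower_tail p (Suc (Suc k)) x)
     = fact (Suc k) * ((\<mu> - x) * lower_tail p (Suc k) x + real (Suc (Suc k)) * lower_tail p (Suc (Suc k)) x)"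
    by (simp add: algebra_simps del: power_Suc)
  then have "\<tau> x * lower_tail p k x - real (Suc k) * (\<tau>' x * lower_tail p (Suc k) x)
       + \<kappa>2 * real (Suc k) * real (Suc (Suc k)) * lower_tail p (Suc (Suc k)) x
     = (\<mu> - x) * lower_tail p (Suc k) x + real (Suc (Suc k)) * lower_tail p (Suc (Suc k)) x"
    by (simp only: mult_cancel_left fact_nonzero simp_thms)
  then show ?thesis
    by (simp add: pearson_q_def algebra_simps)
qed

text \<open>Up to the mean the integrand of \<open>T\<close> is nonnegative, and it is positive on a
  short interval to the left of \<open>x\<close>.\<close>

lemma T_pos_le_mean:
  assumes S: "open S" "x \<in> S" "\<And>y. y \<in> S \<Longrightarrow> 0 < p y" and "x \<le> \<mu>"
  shows "0 < T x"
proof -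
  have nn: "0 \<le> indicator {..x} s * ((\<mu> - s) * p s)" for s
    using nonneg assms by (auto simp: indicator_def)
  then have "0 \<le> T x"
    unfolding T_def by (intro Bochner_Integration.integral_nonneg)
  moreover have "T x \<noteq> 0"
  proof
    assume "T x = 0"
    then have AE: "AE s in lborel. indicator {..x} s * ((\<mu> - s) * p s) = 0"
      using integral_nonneg_eq_0_iff_AE[OF integrable_centred[of x]] nn by (simp add: T_def)
    obtain d where d: "0 < d" "ball x d \<subseteq> S"
      using S open_contains_ball by blast
    \<comment> \<open>The interval stays strictly below \<open>x\<close>, so that
      \<open>\<mu> - s\<close> is positive even when \<open>x = \<mu>\<close>.\<close>
    have "AE s in lborel. s \<notin> {x - d<..<x}"
      using AE
    proof eventually_elim
      case (elim s)
      show ?case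
      proof
        assume s: "s \<in> {x - d<..<x}"
        then have "s \<in> S"
          using d by (auto simp: dist_real_def subset_iff)
        from S(3)[OF this] s elim \<open>x \<le> \<mu>\<close> show False
          by (auto simp: indicator_def)
      qed
    qed
    then have "emeasure lborel {x - d<..<x} = 0"
      by (subst (asm) AE_iff_measurable[where N="{x - d<..<x}"]) auto
    then show False
      using d by simp
  qed
  ultimately show ?thesis by simp
qed

lemma T_pos:
  assumes S: "open S" "x \<in> S" "\<And>y. y \<in> S \<Longrightarrow> 0 < p y"
  shows "0 < T x"
proof (cases "x \<le> \<mu>")
  case False
  interpret r: pearson_density "\<lambda>x. p (- x)" "- \<mu>" \<kappa>2 "- \<kappa>1" \<kappa>0
    by (rule reflect_pearson)
  have "0 < r.T (- x)"
    using S False by (intro r.T_pos_le_mean[of "uminus ` S"]) (auto intro: open_negations)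
  then show ?thesis
    by (simp add: r.T_def T_reflect)
qed (use T_pos_le_mean[OF S] in simp)

end

section \<open>Interval integrals, reflection and iterated derivatives\<close>

lemma interval_integral_lower:
  fixes f :: "real \<Rightarrow> real"
  assumes null: "\<And>t. ereal t \<le> l \<Longrightarrow> f t = 0"
  shows "(LBINT t=l..ereal x. f t) = (LBINT t. indicator {..x} t * f t)"
proof (cases "l \<le> ereal x")
  case True
  have "(LBINT t=l..ereal x. f t) = (LBINT t. indicator (einterval l x) t * f t)"
    using True by (simp add: interval_lebesgue_integral_def set_lebesgue_integral_def)
  also have "\<dots> = (LBINT t. indicator {..x} t * f t)"
    by (rule integral_discrete_difference[of "{x}"])
       (auto simp: indicator_def einterval_def not_less intro: null)
  finally show ?thesis .
next
  case False
  \<comment> \<open>Now \<open>x < l\<close>: the oriented integral runs over \<open>(x, l)\<close>,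
    where \<open>f\<close> vanishes, so both sides are zero.\<close>
  have "f t = 0" if "t \<le> x" for t
    using False that by (intro null) (meson ereal_less_eq(3) linear order_trans)
  then have 1: "indicator {..x} t * f t = 0" for t
    by (simp add: indicator_def)
  have 2: "indicator (einterval x l) t * f t = 0" for t
    by (auto simp: indicator_def einterval_def intro!: null)
  show ?thesis
    using False by (simp add: interval_lebesgue_integral_def set_lebesgue_integral_def 1 2)
qed

lemma upperP_eq_lowerP: "upperP p u k x = lowerP (\<lambda>x. p (- x)) (- u) k (- x)"
proof (induction k arbitrary: x)
  case (Suc k)
  show ?case
    by (simp add: Suc interval_integral_reflect[of "ereal x" u])
qed simp

text \<open>On an open set the equality of \<open>(deriv ^^ k) f\<close> and \<open>F k\<close> may
  itself be differentiated. The second conclusion records existence, which the total function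
  \<open>deriv\<close> does not express.\<close>

lemma iterated_deriv:
  fixes f :: "real \<Rightarrow> real" and F :: "nat \<Rightarrow> real \<Rightarrow> real"
  assumes S: "open S" and f: "\<And>x. x \<in> S \<Longrightarrow> f x = F 0 x"
    and F: "\<And>k x. k < n \<Longrightarrow> x \<in> S \<Longrightarrow> (F k has_real_derivative F (Suc k) x) (at x)"
  shows "k \<le> n \<Longrightarrow> x \<in> S \<Longrightarrow> (deriv ^^ k) f x = F k x"
    and "k < n \<Longrightarrow> x \<in> S \<Longrightarrow> (deriv ^^ k) f differentiable (at x)"
proof -
  have D: "((deriv ^^ k) f has_real_derivative F (Suc k) x) (at x)"
    if "k < n" "x \<in> S" "\<And>y. y \<in> S \<Longrightarrow> (deriv ^^ k) f y = F k y" for k x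
    using has_field_derivative_transform_within_open[OF F[OF that(1,2)] S that(2)] that(3) by simp
  have eq: "k \<le> n \<Longrightarrow> x \<in> S \<Longrightarrow> (deriv ^^ k) f x = F k x" for k x
  proof (induction k arbitrary: x)
    case (Suc k)
    have "((deriv ^^ k) f has_real_derivative F (Suc k) x) (at x)"
      using Suc by (intro D) auto
    then show ?case
      by (simp add: DERIV_imp_deriv)
  qed (simp add: f)
  then show "k \<le> n \<Longrightarrow> x \<in> S \<Longrightarrow> (deriv ^^ k) f x = F k x" .
  show "k < n \<Longrightarrow> x \<in> S \<Longrightarrow> (deriv ^^ k) f differentiable (at x)"
    using D eq by (meson less_imp_le real_differentiable_def)
qed

text \<open>Leibniz' rule stops after three terms because \<phi>'' is constant; the coefficients
  advance by Pascal's rule.\<close>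

lemma DERIV_leibniz_quadratic:
  fixes F :: "nat \<Rightarrow> real \<Rightarrow> real"
  assumes F: "\<And>j. j \<le> k \<Longrightarrow> (F j has_real_derivative F (Suc j) x) (at x)"
    and \<phi>: "(\<phi> has_real_derivative \<phi>' x) (at x)" "(\<phi>' has_real_derivative c) (at x)"
  shows "((\<lambda>x. \<phi> x * F k x + real k * \<phi>' x * F (k - 1) x + real (k choose 2) * c * F (k - 2) x)
    has_real_derivative
      \<phi> x * F (Suc k) x + real (Suc k) * \<phi>' x * F (Suc k - 1) x
        + real (Suc k choose 2) * c * F (Suc k - 2) x) (at x)"
proof -
  have choose: "real (Suc k choose 2) = real (k choose 2) + real k"
    by (simp add: numeral_2_eq_2)
  \<comment> \<open>In the first two cases the truncated indices \<open>k - 1\<close> or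
    \<open>k - 2\<close> are not genuine, but they come with coefficient zero.\<close>
  consider "k = 0" | "k = 1" | j where "k = Suc (Suc j)"
    by (metis One_nat_def not0_implies_Suc)
  then show ?thesis
  proof cases
    case 1
    then show ?thesis
      using F[of 0] \<phi> by (auto intro!: derivative_eq_intros simp: numeral_2_eq_2)
  next
    case 2
    then show ?thesis
      using F[of 0] F[of 1] \<phi> by (auto intro!: derivative_eq_intros simp: numeral_2_eq_2)
  next
    case 3
    have 0: "(F j has_real_derivative F (Suc j) x) (at x)"
      "(F (Suc j) has_real_derivative F (Suc (Suc j)) x) (at x)"
      "(F (Suc (Suc j)) has_real_derivative F (Suc (Suc (Suc j))) x) (at x)"
      using F 3 by auto
    have "((\<lambda>x. \<phi> x * F k x + real k * \<phi>' x * F (Suc j) x + real (k choose 2) * c * F j x)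
      has_real_derivative
        \<phi>' x * F k x + F (Suc k) x * \<phi> x + (real k * (c * F (Suc j) x + F (Suc (Suc j)) x * \<phi>' x))
        + real (k choose 2) * c * F (Suc j) x) (at x)"
      unfolding 3 by (rule derivative_eq_intros 0 \<phi> refl | simp add: algebra_simps)+
    then show ?thesis
      unfolding choose by (simp add: 3 algebra_simps)
  qed
qed

section \<open>Iterated integrals in closed form and their derivatives\<close>

context real_density
begin

lemma lower_tail_null:
  assumes "\<And>s. s \<le> t \<Longrightarrow> p s = 0"
  shows "lower_tail p k t = 0"
proof -
  have 0: "indicator {..t} s * ((t - s) ^ k * p s) = 0" for s
    using assms by (simp add: indicator_def)
  show ?thesis
    unfolding lower_tail_def 0 by simp
qed

lemma lowerP_Suc_eq:
  assumes null: "\<And>t. ereal t \<le> l \<Longrightarrow> p t = 0" and "moment k"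
  shows "lowerP p l (Suc k) x = lower_tail p k x"
  using \<open>moment k\<close>
proof (induction k arbitrary: x)
  case 0
  have "lowerP p l 0 = p"
    by auto
  then show ?case
    by (simp add: interval_integral_lower[OF null] lower_tail_def)
next
  case (Suc k)
  have k: "moment k"
    using Suc.prems by (rule moment_antimono) simp
  have IH: "lowerP p l (Suc k) = lower_tail p k"
    using Suc.IH[OF k] by auto
  have "lower_tail p k t = 0" if t: "ereal t \<le> l" for t
  proof -
    have "p s = 0" if "s \<le> t" for s
      using that by (intro null order_trans[OF _ t]) simp
    then show ?thesis
      by (rule lower_tail_null)
  qed
  then have "(LBINT t=l..ereal x. lower_tail p k t) = lower_tail p (Suc k) x"
    by (simp add: interval_integral_lower lower_tail_Suc(2)[OF Suc.prems])
  then show ?case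
    by (subst lowerP.simps) (simp only: IH)
qed

lemma upperP_Suc_eq:
  assumes null: "\<And>t. u \<le> ereal t \<Longrightarrow> p t = 0" and "moment k"
  shows "upperP p u (Suc k) x = upper_tail p k x"
proof -
  interpret r: real_density "\<lambda>x. p (- x)" by (rule reflect)
  have "p (- t) = 0" if "ereal t \<le> - u" for t
    using that by (intro null) (metis ereal_minus_le_minus ereal_uminus_uminus uminus_ereal.simps(1))
  then show ?thesis
    using assms(2) unfolding upperP_eq_lowerP upper_tail_def
    by (intro r.lowerP_Suc_eq) (simp_all add: moment_reflect)
qed

text \<open>The indexing of \<open>lowerP\<close>, with the density at level 0, so that the
  recurrences below cover their first case uniformly.\<close>

primrec Pl :: "nat \<Rightarrow> real \<Rightarrow> real" where
  "Pl 0 = p"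
| "Pl (Suc k) = lower_tail p k"

primrec Pu :: "nat \<Rightarrow> real \<Rightarrow> real" where
  "Pu 0 = p"
| "Pu (Suc k) = upper_tail p k"

lemma Pu_eq: "Pu k x = real_density.Pl (\<lambda>x. p (- x)) k (- x)"
proof -
  interpret r: real_density "\<lambda>x. p (- x)" by (rule reflect)
  show ?thesis
    by (cases k) (simp_all add: upper_tail_def)
qed

lemma integrable_Pl: "moment k \<Longrightarrow> integrable lborel (\<lambda>t. indicator {..x} t * Pl k t)"
  using moment_shift[OF moment_0, of "{..x}"] lower_tail_Suc(1) by (cases k) simp_all

lemma Pl_Suc: "moment k \<Longrightarrow> Pl (Suc k) x = (LBINT t. indicator {..x} t * Pl k t)"
  using lower_tail_Suc(2)[of "k - 1"] by (cases k) (simp_all add: lower_tail_def)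

text \<open>Differentiating level \<open>k + 1\<close> requires continuity of level
  \<open>k\<close>. This is inherited upwards, because each level is differentiable once the one
  below is continuous.\<close>

lemma DERIV_Pl:
  assumes mom: "moment k" and S: "open S" "x \<in> S" and cont: "continuous_on S p"
  shows "(Pl (Suc k) has_real_derivative Pl k x) (at x)"
proof -
  have *: "(Pl (Suc k) has_real_derivative Pl k x) (at x)"
    if "moment k" "x \<in> S" "continuous_on S (Pl k)" for k x
    using DERIV_lower_integral[OF integrable_Pl[OF that(1)] S(1) that(2,3)]
    by (simp only: Pl_Suc[OF that(1), symmetric])
  have "continuous_on S (Pl k)"
    using mom
  proof (induction k)
    case 0
    then show ?case using cont by simp
  next
    case (Suc k)
    then have "moment k"
      by (elim moment_antimono) simp
    with Suc.IH show ?case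
      by (intro DERIV_continuous_on[of S "Pl (Suc k)" "Pl k"] DERIV_subset[OF *]) auto
  qed
  then show ?thesis
    using * mom S(2) by blast
qed

end

subsection \<open>Recurrences and Wronskian\<close>

context pearson_density
begin

lemma \<tau>_reflect: "pearson_density.\<tau> \<kappa>2 (- \<kappa>1) \<kappa>0 (- x) = \<tau> x"
  and \<tau>'_reflect: "pearson_density.\<tau>' \<kappa>2 (- \<kappa>1) (- x) = - \<tau>' x"
  and T_reflect': "pearson_density.T (\<lambda>x. p (- x)) (- \<mu>) (- x) = T x"
proof -
  interpret r: pearson_density "\<lambda>x. p (- x)" "- \<mu>" \<kappa>2 "- \<kappa>1" \<kappa>0
    by (rule reflect_pearson)
  show "r.\<tau> (- x) = \<tau> x" "r.\<tau>' (- x) = - \<tau>' x" "r.T (- x) = T x"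
    by (simp_all add: r.\<tau>_def \<tau>_def r.\<tau>'_def \<tau>'_def r.T_def T_reflect)
qed

text \<open>At \<open>k = 0\<close> this is the splitting of \<open>T\<close> into the first two
  tails, with \<open>q\<close> at 1 equal to 1; for larger \<open>k\<close> it is the recurrence for
  \<open>lower_tail\<close>.\<close>

lemma Pl_recurrence:
  assumes "moment (Suc k)" "\<tau> x * p x = T x"
  shows "\<tau> x * Pl k x - (real k * \<tau>' x + \<mu> - x) * Pl (Suc k) x
    = pearson_q \<kappa>2 (Suc k) * Pl (Suc (Suc k)) x"
proof (cases k)
  case 0
  then show ?thesis
    using assms by (simp add: T_eq_tails pearson_q_def)
next
  case (Suc j)
  with assms(1) lower_tail_recurrence[of j x] show ?thesis
    by simp
qed

text \<open>The coefficient of the middle term is odd under reflection, which gives it the sign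
  opposite to the lower recurrence.\<close>

lemma Pu_recurrence:
  assumes "moment (Suc k)" "\<tau> x * p x = T x"
  shows "\<tau> x * Pu k x + (real k * \<tau>' x + \<mu> - x) * Pu (Suc k) x
    = pearson_q \<kappa>2 (Suc k) * Pu (Suc (Suc k)) x"
proof -
  interpret r: pearson_density "\<lambda>x. p (- x)" "- \<mu>" \<kappa>2 "- \<kappa>1" \<kappa>0
    by (rule reflect_pearson)
  show ?thesis
    using r.Pl_recurrence[of k "- x"] assms
    by (simp add: \<tau>_reflect \<tau>'_reflect T_reflect' Pu_eq moment_reflect algebra_simps del: r.Pl.simps Pu.simps)
qed

end

locale pearson_density_on = pearson_density +
  fixes S :: "real set" and N :: nat
  assumes open_S: "open S"
    and pos: "\<And>x. x \<in> S \<Longrightarrow> 0 < p x"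
    and kernel_on: "\<And>x. x \<in> S \<Longrightarrow> \<tau> x * p x = T x"
    and cont: "continuous_on S p"
    and adm: "admissible \<kappa>2 N"
begin

lemma moment_le: "k \<le> N \<Longrightarrow> moment k"
  using moment_antimono[OF moment_admissible[OF adm]] .

lemma T_pos_on: "x \<in> S \<Longrightarrow> 0 < T x"
  using T_pos[OF open_S] pos by blast

lemma \<tau>_pos: "x \<in> S \<Longrightarrow> 0 < \<tau> x"
  using T_pos_on[of x] pos[of x] kernel_on[of x] by (metis zero_less_mult_pos2)

lemma DERIV_\<tau>: "(\<tau> has_real_derivative \<tau>' x) (at x)"
  unfolding \<tau>_def \<tau>'_def by (auto intro!: derivative_eq_intros)

lemma DERIV_T:
  assumes "x \<in> S"
  shows "(T has_real_derivative (\<mu> - x) * p x) (at x)"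
  unfolding T_def
  by (rule DERIV_lower_integral[OF integrable_centred open_S assms])
     (intro continuous_intros cont)

definition Q :: "nat \<Rightarrow> real" where
  "Q k = (\<Prod>j\<in>{1..k}. pearson_q \<kappa>2 j)"

lemma Q_0 [simp]: "Q 0 = 1"
  by (simp add: Q_def)

lemma Q_Suc: "Q (Suc k) = pearson_q \<kappa>2 (Suc k) * Q k"
  by (simp add: Q_def)

lemma q_pos: "0 < k \<Longrightarrow> k \<le> N \<Longrightarrow> 0 < pearson_q \<kappa>2 k"
  using adm by (auto simp: admissible_def)

lemma Q_pos: "k \<le> N \<Longrightarrow> 0 < Q k"
  unfolding Q_def using q_pos by (intro prod_pos) auto

text \<open>The \<open>k\<close>-th derivatives of the lower and the upper distribution function divided by \<open>\<tau> p\<close>.\<close>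

definition B :: "nat \<Rightarrow> real \<Rightarrow> real" where
  "B k x = Q k * Pl (Suc k) x / (\<tau> x ^ k * T x)"

definition A :: "nat \<Rightarrow> real \<Rightarrow> real" where
  "A k x = (- 1) ^ k * (Q k * Pu (Suc k) x / (\<tau> x ^ k * T x))"

text \<open>By \<open>T' = (\<mu> - x) * p\<close> and \<open>p = T / \<tau>\<close>, the quotient
  rule produces the left-hand side of \<open>Pl_recurrence\<close>; the factor \<open>q\<close> on
  its right-hand side is collected in \<open>Q\<close>.\<close>

lemma DERIV_B:
  assumes k: "k < N" and x: "x \<in> S"
  shows "(B k has_real_derivative B (Suc k) x) (at x)"
proof -
  have nz: "\<tau> x \<noteq> 0" "T x \<noteq> 0"
    using \<tau>_pos[OF x] T_pos_on[OF x] by auto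
  have p: "p x = T x / \<tau> x"
    using kernel_on[OF x] nz by (simp add: field_simps)
  have D: "(B k has_real_derivative
      (Q k * Pl k x * (\<tau> x ^ k * T x)
        - Q k * Pl (Suc k) x * (real k * \<tau> x ^ (k - 1) * \<tau>' x * T x + \<tau> x ^ k * ((\<mu> - x) * p x)))
      / ((\<tau> x ^ k * T x) * (\<tau> x ^ k * T x))) (at x)"
    unfolding B_def
    using nz DERIV_Pl[OF moment_le[OF less_imp_le[OF k]] open_S x cont]
    by (auto intro!: derivative_eq_intros DERIV_\<tau> DERIV_T x simp del: Pl.simps)
  have E: "real k * \<tau> x ^ (k - 1) * \<tau>' x * T x + \<tau> x ^ k * ((\<mu> - x) * p x)
     = (real k * \<tau>' x + \<mu> - x) * \<tau> x ^ k * T x / \<tau> x"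
    unfolding p using nz by (cases k) (simp_all add: field_simps)
  have "(Q k * Pl k x * (\<tau> x ^ k * T x)
        - Q k * Pl (Suc k) x * (real k * \<tau> x ^ (k - 1) * \<tau>' x * T x + \<tau> x ^ k * ((\<mu> - x) * p x)))
      / ((\<tau> x ^ k * T x) * (\<tau> x ^ k * T x))
    = Q k * (\<tau> x * Pl k x - (real k * \<tau>' x + \<mu> - x) * Pl (Suc k) x) / (\<tau> x ^ Suc k * T x)"
    unfolding E using nz by (simp add: field_simps del: Pl.simps)
  also have "\<dots> = B (Suc k) x"
    using Pl_recurrence[OF moment_le kernel_on[OF x], of k] k
    by (simp add: B_def Q_Suc mult_ac del: Pl.simps power_Suc)
  finally show ?thesis
    using D by simp
qed

lemma reflect_on: "pearson_density_on (\<lambda>x. p (- x)) (- \<mu>) \<kappa>2 (- \<kappa>1) \<kappa>0 (uminus ` S) N"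
proof -
  interpret r: pearson_density "\<lambda>x. p (- x)" "- \<mu>" \<kappa>2 "- \<kappa>1" \<kappa>0
    by (rule reflect_pearson)
  show ?thesis
    using open_S pos kernel_on adm
    by unfold_locales
       (auto simp: \<tau>_reflect T_reflect' open_negations
         intro!: continuous_on_compose2[OF cont] continuous_intros)
qed

text \<open>\<open>A\<close> is the \<open>B\<close> of the reflected density at \<open>- x\<close>,
  up to the sign \<open>(- 1) ^ k\<close>, which absorbs the inner derivative of the
  reflection.\<close>

lemma DERIV_A:
  assumes k: "k < N" and x: "x \<in> S"
  shows "(A k has_real_derivative A (Suc k) x) (at x)"
proof -
  interpret r: pearson_density_on "\<lambda>x. p (- x)" "- \<mu>" \<kappa>2 "- \<kappa>1" \<kappa>0 "uminus ` S" N
    by (rule reflect_on)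
  have A_eq: "A k x = (- 1) ^ k * r.B k (- x)" for k x
    by (simp only: A_def r.B_def Q_def r.Q_def \<tau>_reflect T_reflect' Pu_eq)
  have "(r.B k has_real_derivative r.B (Suc k) (- x)) (at (- x))"
    using k x by (intro r.DERIV_B) auto
  then have "((\<lambda>x. r.B k (- x)) has_real_derivative - r.B (Suc k) (- x)) (at x)"
    by (simp add: DERIV_mirror)
  then show ?thesis
    unfolding A_eq by (auto intro!: derivative_eq_intros)
qed

text \<open>Inserting both recurrences, the middle terms cancel by their opposite signs, and
  \<open>\<tau>\<close> times the expression of the previous level remains. The base case is that
  the two tails sum to 1.\<close>

lemma wronskian:
  assumes "k \<le> N" and x: "x \<in> S"
  shows "Q k * \<tau> x * (Pu (Suc k) x * Pl k x + Pl (Suc k) x * Pu k x) = \<tau> x ^ k * T x"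
  using assms(1)
proof (induction k)
  case 0
  have "\<tau> x * (upper_tail p 0 x * p x + lower_tail p 0 x * p x) = \<tau> x * p x * (lower_tail p 0 x + upper_tail p 0 x)"
    by (simp add: algebra_simps)
  then show ?case
    using kernel_on[OF x] by (simp add: tails_sum)
next
  case (Suc k)
  have m: "moment (Suc k)"
    using Suc.prems by (rule moment_le)
  have "Q (Suc k) * \<tau> x * (Pu (Suc (Suc k)) x * Pl (Suc k) x + Pl (Suc (Suc k)) x * Pu (Suc k) x)
    = Q k * \<tau> x * ((pearson_q \<kappa>2 (Suc k) * Pu (Suc (Suc k)) x) * Pl (Suc k) x
        + (pearson_q \<kappa>2 (Suc k) * Pl (Suc (Suc k)) x) * Pu (Suc k) x)"
    by (simp add: Q_Suc algebra_simps del: Pl.simps Pu.simps)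
  also have "\<dots> = \<tau> x * (Q k * \<tau> x * (Pu (Suc k) x * Pl k x + Pl (Suc k) x * Pu k x))"
    unfolding Pl_recurrence[OF m kernel_on[OF x], symmetric] Pu_recurrence[OF m kernel_on[OF x], symmetric]
    by (simp add: algebra_simps del: Pl.simps Pu.simps)
  also have "\<dots> = \<tau> x ^ Suc k * T x"
    using Suc by simp
  finally show ?case .
qed

lemma wronskian_AB:
  assumes "k \<le> N" "x \<in> S"
  shows "(- 1) ^ k * A k x * Pl k x + B k x * Pu k x = 1 / \<tau> x"
proof -
  have nz: "\<tau> x \<noteq> 0" "T x \<noteq> 0"
    using \<tau>_pos[OF assms(2)] T_pos_on[OF assms(2)] by auto
  have "(- 1) ^ k * A k x * Pl k x + B k x * Pu k x
     = Q k * \<tau> x * (Pu (Suc k) x * Pl k x + Pl (Suc k) x * Pu k x) / (\<tau> x * (\<tau> x ^ k * T x))"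
    using nz by (simp add: A_def B_def field_simps del: Pl.simps Pu.simps flip: power_mult_distrib)
  also have "\<dots> = 1 / \<tau> x"
    unfolding wronskian[OF assms] using nz by simp
  finally show ?thesis .
qed

lemma cross_AB_same: "(- 1) ^ k * A k x * Pl (Suc k) x = B k x * Pu (Suc k) x"
  by (simp add: A_def B_def flip: power_mult_distrib)

text \<open>The Wronskian of index \<open>k + 1\<close>, rewritten with \<open>A\<^sub>k\<close> and \<open>B\<^sub>k\<close>.\<close>

lemma cross_AB_Suc:
  assumes "Suc k \<le> N" "x \<in> S"
  shows "(- 1) ^ k * A k x * Pl (Suc (Suc k)) x + B k x * Pu (Suc (Suc k)) x = 1 / pearson_q \<kappa>2 (Suc k)"
proof -
  have nz: "\<tau> x \<noteq> 0" "T x \<noteq> 0" "pearson_q \<kappa>2 (Suc k) \<noteq> 0" "Q k \<noteq> 0"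
    using \<tau>_pos[OF assms(2)] T_pos_on[OF assms(2)] q_pos[of "Suc k"] Q_pos[of k] assms(1) by auto
  have "(- 1) ^ k * A k x * Pl (Suc (Suc k)) x + B k x * Pu (Suc (Suc k)) x
     = Q (Suc k) * \<tau> x * (Pu (Suc (Suc k)) x * Pl (Suc k) x + Pl (Suc (Suc k)) x * Pu (Suc k) x)
       / (pearson_q \<kappa>2 (Suc k) * (\<tau> x ^ Suc k * T x))"
    using nz by (simp add: A_def B_def Q_Suc field_simps del: Pl.simps Pu.simps flip: power_mult_distrib)
  also have "\<dots> = 1 / pearson_q \<kappa>2 (Suc k)"
    unfolding wronskian[OF assms] using nz by simp
  finally show ?thesis .
qed

end

section \<open>Continuity, measurability and vanishing of the tails\<close>

lemma locally_abs_cont_on_imp_continuous_on: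
  assumes lac: "locally_abs_cont_on f S" and S: "open S"
  shows "continuous_on S f"
  unfolding continuous_on_eq_continuous_at[OF S]
proof
  fix x assume "x \<in> S"
  then obtain d where d: "0 < d" "cball x d \<subseteq> S"
    using S open_contains_cball by blast
  have Icc: "{x - d..x + d} \<subseteq> S"
    using d by (auto simp: dist_real_def subset_iff)
  show "isCont f x"
    unfolding continuous_at_eps_delta
  proof (intro allI impI)
    fix \<epsilon> :: real assume "0 < \<epsilon>"
    moreover have "x - d \<le> x + d \<and> {x - d..x + d} \<subseteq> S"
      using Icc d(1) by simp
    ultimately obtain \<delta> where \<delta>: "0 < \<delta>"
      and D: "\<And>D. finite D \<and> (\<forall>(s, t)\<in>D. x - d \<le> s \<and> s \<le> t \<and> t \<le> x + d) \<and>
           pairwise (\<lambda>(s, t) (s', t'). {s<..<t} \<inter> {s'<..<t'} = {}) D \<and>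
           (\<Sum>(s, t)\<in>D. t - s) < \<delta> \<Longrightarrow> (\<Sum>(s, t)\<in>D. \<bar>f t - f s\<bar>) < \<epsilon>"
      using lac[unfolded locally_abs_cont_on_def, rule_format, of "x - d" "x + d" \<epsilon>] by blast
    show "\<exists>\<delta>>0. \<forall>y. dist y x < \<delta> \<longrightarrow> dist (f y) (f x) < \<epsilon>"
    proof (intro exI conjI allI impI)
      show "0 < min \<delta> d"
        using \<delta> d by simp
      fix y assume "dist y x < min \<delta> d"
      \<comment> \<open>A family of one interval suffices; \<open>min\<close> and \<open>max\<close>
        cover both orders of \<open>x\<close> and \<open>y\<close>.\<close>
      then show "dist (f y) (f x) < \<epsilon>"
        using D[of "{(min x y, max x y)}"] by (cases "x \<le> y") (auto simp: dist_real_def abs_minus_commute)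
    qed
  qed
qed

context real_density
begin

lemma Pl_null:
  assumes "\<And>s. s \<le> t \<Longrightarrow> p s = 0"
  shows "Pl k t = 0"
  using assms lower_tail_null by (cases k) auto

lemma Pu_null:
  assumes "\<And>s. t \<le> s \<Longrightarrow> p s = 0"
  shows "Pu k t = 0"
proof -
  interpret r: real_density "\<lambda>x. p (- x)" by (rule reflect)
  show ?thesis
    unfolding Pu_eq using assms by (intro r.Pl_null) simp
qed

lemma measurable_Pl [measurable]: "Pl k \<in> borel_measurable borel"
proof (cases k)
  case (Suc j)
  have "(\<lambda>x. (LBINT s. indicator {..x} s * ((x - s) ^ j * p s)) / fact j) \<in> borel_measurable borel"
    unfolding indicator_def atMost_iff by measurable
  then show ?thesis
    unfolding Suc Pl.simps lower_tail_def[abs_def] .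
qed simp

lemma measurable_Pu [measurable]: "Pu k \<in> borel_measurable borel"
proof -
  interpret r: real_density "\<lambda>x. p (- x)" by (rule reflect)
  show ?thesis
    unfolding Pu_eq[abs_def] by measurable
qed

lemma
  assumes "moment k"
  shows integrable_Pu: "integrable lborel (\<lambda>t. indicator {x<..} t * Pu k t)"
    and Pu_Suc: "Pu (Suc k) x = (LBINT t. indicator {x<..} t * Pu k t)"
proof -
  interpret r: real_density "\<lambda>x. p (- x)" by (rule reflect)
  have m: "r.moment k"
    using assms by (simp add: moment_reflect)
  \<comment> \<open>Reflecting \<open>{..- x}\<close> gives the closed half-line, whereas
    \<open>stein_K\<close> uses the open one; they differ in one point.\<close>
  have ae: "AE t in lborel. indicator {..- x} (- t) * r.Pl k (- t) = indicator {x<..} t * Pu k t"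
    using AE_lborel_singleton[of x] by (auto simp: Pu_eq indicator_def)
  have int: "integrable lborel (\<lambda>t. indicator {..- x} (- t) * r.Pl k (- t))"
    using lborel_integrable_real_affine[OF r.integrable_Pl[OF m, of "- x"], of "-1" 0] by simp
  then show "integrable lborel (\<lambda>t. indicator {x<..} t * Pu k t)"
    by (rule integrable_cong_AE_imp[OF _ _ ae]) measurable
  have "Pu (Suc k) x = (LBINT t. indicator {..- x} t * r.Pl k t)"
    unfolding Pu_eq by (rule r.Pl_Suc[OF m])
  also have "\<dots> = (LBINT t. indicator {..- x} (- t) * r.Pl k (- t))"
    by (subst lborel_integral_real_affine[of "-1" _ 0]) simp_all
  also have "\<dots> = (LBINT t. indicator {x<..} t * Pu k t)"
    by (rule integral_cong_AE[OF _ _ ae]) measurable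
  finally show "Pu (Suc k) x = (LBINT t. indicator {x<..} t * Pu k t)" .
qed

end

section \<open>Leibniz expansions paired with the tails\<close>

definition leibniz :: "(nat \<Rightarrow> real \<Rightarrow> real) \<Rightarrow> (real \<Rightarrow> real) \<Rightarrow> (real \<Rightarrow> real) \<Rightarrow> real \<Rightarrow> nat \<Rightarrow> real \<Rightarrow> real" where
  "leibniz F \<phi> \<phi>' c k x = \<phi> x * F k x + real k * \<phi>' x * F (k - 1) x + real (k choose 2) * c * F (k - 2) x"

context pearson_density_on
begin

text \<open>Of the three Leibniz terms, the one of order \<open>k\<close> gives the Wronskian, the
  one of order \<open>k - 1\<close> cancels, and the one of order \<open>k - 2\<close> gives the
  constant from \<open>cross_AB_Suc\<close>.\<close>

lemma leibniz_AB:
  assumes k: "k \<le> N" "1 \<le> k" and x: "x \<in> S"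
  shows "(- 1) ^ (k - 1) * leibniz A \<phi> \<phi>' c k x * Pl k x - leibniz B \<phi> \<phi>' c k x * Pu k x
    = - \<phi> x / \<tau> x - real (k choose 2) * c / pearson_q \<kappa>2 (k - 1)"
proof -
  obtain j where j: "k = Suc j"
    using k by (cases k) auto
  let ?D = "\<lambda>i. (- 1) ^ j * A i x * Pl k x - B i x * Pu k x"
  have top: "?D k = - 1 / \<tau> x"
    using wronskian_AB[OF k(1) x] j by simp
  have mid: "?D j = 0"
    using cross_AB_same[of j x] j by simp
  have low: "real (k choose 2) * ?D (k - 2) = - real (k choose 2) / pearson_q \<kappa>2 j"
  proof (cases j)
    case 0
    then show ?thesis by (simp add: j numeral_2_eq_2)
  next
    case (Suc i)
    have D: "?D i = - 1 / pearson_q \<kappa>2 j" and i: "k - 2 = i"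
      using cross_AB_Suc[of i x] k j Suc x by simp_all
    show ?thesis
      unfolding i D by simp
  qed
  have "(- 1) ^ j * leibniz A \<phi> \<phi>' c k x * Pl k x - leibniz B \<phi> \<phi>' c k x * Pu k x
    = \<phi> x * ?D k + real k * \<phi>' x * ?D j + c * (real (k choose 2) * ?D (k - 2))"
    unfolding leibniz_def j diff_Suc_1 by (simp add: algebra_simps del: Pl.simps Pu.simps binomial_Suc_Suc)
  then show ?thesis
    unfolding top mid low by (simp add: j)
qed

text \<open>Against the tails one level higher, the leading term is the one that cancels, and the
  \<phi>' term meets the constant of \<open>cross_AB_Suc\<close>. This is the source of the factor
  \<open>k / q\<close>.\<close>

lemma leibniz_AB_Suc:
  assumes k: "k \<le> N" "1 \<le> k" and x: "x \<in> S"
  shows "(- 1) ^ k * leibniz A \<phi> \<phi>' 0 k x * Pl (Suc k) x - leibniz B \<phi> \<phi>' 0 k x * Pu (Suc k) x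
    = - (real k / pearson_q \<kappa>2 k * \<phi>' x)"
proof -
  obtain j where j: "k = Suc j"
    using k by (cases k) auto
  let ?D = "\<lambda>i. (- 1) ^ k * A i x * Pl (Suc k) x - B i x * Pu (Suc k) x"
  have top: "?D k = 0"
    using cross_AB_same[of k x] by simp
  have mid: "?D j = - 1 / pearson_q \<kappa>2 k"
    using cross_AB_Suc[of j x] k x j by simp
  have "(- 1) ^ k * leibniz A \<phi> \<phi>' 0 k x * Pl (Suc k) x - leibniz B \<phi> \<phi>' 0 k x * Pu (Suc k) x
    = \<phi> x * ?D k + real k * \<phi>' x * ?D j"
    unfolding leibniz_def j diff_Suc_1 by (simp add: algebra_simps del: Pl.simps Pu.simps)
  then show ?thesis
    unfolding top mid by simp
qed

lemma
  assumes \<phi>: "\<And>x. x \<in> S \<Longrightarrow> (\<phi> has_real_derivative \<phi>' x) (at x)"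
    "\<And>x. x \<in> S \<Longrightarrow> (\<phi>' has_real_derivative c) (at x)"
    and k: "k < N" and x: "x \<in> S"
  shows DERIV_leibniz_A: "(leibniz A \<phi> \<phi>' c k has_real_derivative leibniz A \<phi> \<phi>' c (Suc k) x) (at x)"
    and DERIV_leibniz_B: "(leibniz B \<phi> \<phi>' c k has_real_derivative leibniz B \<phi> \<phi>' c (Suc k) x) (at x)"
  unfolding leibniz_def[abs_def]
  by (rule DERIV_leibniz_quadratic; use \<phi> k x in \<open>auto intro: DERIV_A DERIV_B\<close>)+

end

subsection \<open>The Stein setting\<close>

context stein_setting
begin

lemma p_pos_iff: "0 < p x \<longleftrightarrow> x \<in> supp"
  using p_pos_set by auto

lemma open_supp: "open supp"
  unfolding supp_set_def by auto

lemma e_mono: "i \<le> j \<Longrightarrow> j \<le> m \<Longrightarrow> e i \<le> e j"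
proof (induction j rule: dec_induct)
  case (step j)
  have "e j < e (Suc j)"
    using e_less[of "Suc j"] step.prems by simp
  with step show ?case
    by (auto intro: order_trans less_imp_le)
qed simp

lemma supp_bounds:
  assumes "x \<in> supp"
  shows "e 0 < ereal x" "ereal x < e m"
proof -
  obtain r where r: "r \<in> {1..m}" "e (r - 1) < ereal x" "ereal x < e r"
    using assms by (auto simp: supp_set_def einterval_def)
  moreover have "e 0 \<le> e (r - 1)" "e r \<le> e m"
    using r(1) by (auto intro!: e_mono)
  ultimately show "e 0 < ereal x" "ereal x < e m"
    by (auto intro: order_le_less_trans order_less_le_trans)
qed

lemma p_null: "x \<notin> supp \<Longrightarrow> p x = 0"
  using p_pos_iff[of x] p_nonneg[of x] by linarith

lemma p_null_lower: "ereal t \<le> e 0 \<Longrightarrow> p t = 0"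
  using supp_bounds[of t] by (intro p_null) auto

lemma p_null_upper: "e m \<le> ereal t \<Longrightarrow> p t = 0"
  using supp_bounds[of t] by (intro p_null) auto

text \<open>For the least \<open>r\<close> with \<open>x \<le> e r\<close>, the point lies in the
  half-open interval up to \<open>e r\<close>; being off the support leaves only its right
  end.\<close>

lemma breakpoint:
  assumes "x \<notin> supp" "e 0 < ereal x" "ereal x < e m"
  shows "ereal x \<in> e ` {..m}"
proof -
  define r where "r = (LEAST r. ereal x \<le> e r)"
  have r: "ereal x \<le> e r" "r \<le> m"
    unfolding r_def using assms(3) by (auto intro: LeastI[of _ m] Least_le)
  have "r \<noteq> 0"
    using r assms(2) by (intro notI) auto
  then have "\<not> ereal x \<le> e (r - 1)"
    unfolding r_def by (intro not_less_Least) simp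
  moreover have "r \<in> {1..m}"
    using \<open>r \<noteq> 0\<close> r(2) by simp
  ultimately have "\<not> ereal x < e r"
    using assms(1) by (auto simp: supp_set_def einterval_def)
  with r show ?thesis
    by (auto intro!: image_eqI[of _ _ r])
qed

lemma AE_supp_cases:
  "AE x in lborel. x \<in> supp \<or> ereal x \<le> e 0 \<or> e m \<le> ereal x"
proof -
  have "finite {x. ereal x \<in> e ` {..m}}"
    using finite_vimageI[of "e ` {..m}" ereal] by (simp add: vimage_def inj_on_def)
  then have "{x. ereal x \<in> e ` {..m}} \<in> null_sets lborel"
    by (rule finite_imp_null_set_lborel)
  then have "AE x in lborel. x \<notin> {x. ereal x \<in> e ` {..m}}"
    by (rule AE_not_in)
  then show ?thesis
  proof eventually_elim
    case (elim x)
    then show ?case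
      using breakpoint[of x] by (auto simp: not_le)
  qed
qed

lemma measurable_p [measurable]: "p \<in> borel_measurable borel"
  using distributed_real_measurable[OF _ density_Z] p_nonneg by simp

lemma expectation_Z:
  "g \<in> borel_measurable borel \<Longrightarrow> expectation (\<lambda>\<omega>. g (Z \<omega>)) = (LBINT t. p t * g t)"
  using distributed_integral[OF density_Z, of g] p_nonneg by simp

lemma integrable_Z:
  "g \<in> borel_measurable borel \<Longrightarrow> integrable M (\<lambda>\<omega>. g (Z \<omega>)) \<longleftrightarrow> integrable lborel (\<lambda>t. p t * g t)"
  using distributed_integrable[OF density_Z, of g] p_nonneg by simp

lemma real_density: "real_density p"
proof
  show "has_bochner_integral lborel p 1"
    using integrable_Z[of "\<lambda>_. 1"] expectation_Z[of "\<lambda>_. 1"]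
    by (simp add: has_bochner_integral_iff prob_space)
qed (rule p_nonneg)

lemma continuous_on_p: "continuous_on supp p"
  unfolding supp_set_def
  by (intro continuous_on_open_UN locally_abs_cont_on_imp_continuous_on p_lac) auto

end

section \<open>The Pearson family in the Stein setting\<close>

locale pearson_stein = stein_setting +
  fixes \<kappa>2 \<kappa>1 \<kappa>0 :: real and n :: nat
  assumes pearson: "integrated_pearson \<kappa>2 \<kappa>1 \<kappa>0" and admissible: "admissible \<kappa>2 n"

sublocale pearson_stein \<subseteq> pd: pearson_density_on p "expectation Z" \<kappa>2 \<kappa>1 \<kappa>0 supp n
proof -
  let ?\<mu> = "expectation Z"
  let ?T = "\<lambda>t. LBINT s. indicator {..t} s * ((?\<mu> - s) * p s)"
  interpret real_density p by (rule real_density)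
  have Z: "integrable M Z"
    using pearson by (simp add: integrated_pearson_def)
  have mean_int: "integrable lborel (\<lambda>t. p t * t)"
    using Z integrable_Z[of "\<lambda>t. t"] by simp
  moreover have mean_eq: "(LBINT t. p t * t) = ?\<mu>"
    using expectation_Z[of "\<lambda>t. t"] by simp
  ultimately have mean: "has_bochner_integral lborel (\<lambda>t. t * p t) ?\<mu>"
    by (simp add: has_bochner_integral_iff mult.commute)
  have kernel_supp: "(\<kappa>2 * x\<^sup>2 + \<kappa>1 * x + \<kappa>0) * p x = ?T x" if x: "x \<in> supp" for x
  proof -
    have "\<kappa>2 * x\<^sup>2 + \<kappa>1 * x + \<kappa>0 = 1 / p x * ?T x"
      using pearson x unfolding integrated_pearson_def stein_kernel_def
      by (subst (asm) interval_integral_lower) (auto simp: p_null_lower)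
    then show ?thesis
      using x p_pos_iff[of x] by (simp add: field_simps)
  qed
  have "(LBINT s. (?\<mu> - s) * p s) = (LBINT s. ?\<mu> * p s - p s * s)"
    by (simp add: algebra_simps)
  also have "\<dots> = 0"
    using prob mean_int mean_eq by (simp add: has_bochner_integral_iff)
  finally have total: "(LBINT s. (?\<mu> - s) * p s) = 0" .
  have "AE x in lborel. (\<kappa>2 * x\<^sup>2 + \<kappa>1 * x + \<kappa>0) * p x = ?T x"
    using AE_supp_cases
  proof eventually_elim
    case (elim x)
    consider "x \<in> supp" | "ereal x \<le> e 0" | "e m \<le> ereal x"
      using elim by blast
    then show ?case
    proof cases
      case 1
      then show ?thesis by (rule kernel_supp)
    next
      case 2
      then have "p s = 0" if "s \<le> x" for s
        using that by (intro p_null_lower) (metis ereal_less_eq(3) order_trans)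
      then have 0: "indicator {..x} s * ((?\<mu> - s) * p s) = 0" for s
        by (simp add: indicator_def)
      show ?thesis
        unfolding 0 using 2 by (simp add: p_null_lower)
    next
      case 3
      then have "p s = 0" if "x \<le> s" for s
        using that by (intro p_null_upper) (metis ereal_less_eq(3) order_trans)
      \<comment> \<open>Beyond the upper end, the partial integral is already the total one, which
        is zero by the choice of the mean.\<close>
      then have 0: "indicator {..x} s * ((?\<mu> - s) * p s) = (?\<mu> - s) * p s" for s
        by (cases "s \<le> x") auto
      show ?thesis
        unfolding 0 total using 3 by (simp add: p_null_upper)
    qed
  qed
  with mean interpret pearson_density p ?\<mu> \<kappa>2 \<kappa>1 \<kappa>0
    by unfold_locales
  show "pearson_density_on p ?\<mu> \<kappa>2 \<kappa>1 \<kappa>0 supp n"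
    using open_supp p_pos_iff kernel_supp continuous_on_p admissible
    by unfold_locales (auto simp: \<tau>_def T_def)
qed

context pearson_stein
begin

text \<open>Level \<open>Suc n\<close> is covered by the \<open>n\<close> moments available and is
  the highest level that \<open>MM n (int n)\<close> involves.\<close>

lemma lowerP_eq: "k \<le> Suc n \<Longrightarrow> lowerP p (e 0) k x = pd.Pl k x"
  using pd.lowerP_Suc_eq[OF p_null_lower pd.moment_le, where k = "k - 1" and x = x] by (cases k) auto

lemma upperP_eq: "k \<le> Suc n \<Longrightarrow> upperP p (e m) k x = pd.Pu k x"
  using pd.upperP_Suc_eq[OF p_null_upper pd.moment_le, where k = "k - 1" and x = x] by (cases k) auto

lemma stein_kernel_eq: "x \<in> supp \<Longrightarrow> stein_kernel p (e 0) (expectation Z) x = pd.\<tau> x"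
  using pearson by (simp add: integrated_pearson_def pd.\<tau>_def)

lemma measurable_K:
  assumes "j \<le> Suc n"
  shows "K i j x \<in> borel_measurable borel"
  unfolding stein_K_def[abs_def] lowerP_eq[OF assms] upperP_eq[OF assms] by measurable

text \<open>The density cancels the factor \<open>1 / p v\<close> of the kernel, so taking the
  expectation integrates the two tails once more, which raises their level to the one in
  \<open>MM\<close>.\<close>

lemma
  assumes j: "j \<le> n" and x: "x \<in> supp"
  shows integrable_K: "integrable M (\<lambda>\<omega>. K i j x (Z \<omega>))"
    and expectation_K: "expectation (\<lambda>\<omega>. K i j x (Z \<omega>)) = MM i (int j) x"
proof -
  let ?u = "(deriv ^^ i) (m_upper p w (e m)) x" and ?l = "(deriv ^^ i) (m_lower p w (e 0)) x"
  let ?g = "\<lambda>t. (- 1) ^ j * ?u * (indicator {..x} t * pd.Pl j t) - ?l * (indicator {x<..} t * pd.Pu j t)"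
  have j': "j \<le> Suc n" using j by simp
  have mom: "pd.moment j" using j by (rule pd.moment_le)
  note int = pd.integrable_Pl[OF mom, of x] pd.integrable_Pu[OF mom, of x]
  have ae: "AE t in lborel. p t * K i j x t = ?g t"
    using AE_supp_cases
  proof eventually_elim
    case (elim t)
    show ?case
    proof (cases "t \<in> supp")
      case True
      then have "p t \<noteq> 0" using p_pos_iff[of t] by simp
      then show ?thesis
        by (simp add: stein_K_def lowerP_eq[OF j'] upperP_eq[OF j'] mult_ac)
    next
      case False
      then consider "ereal t \<le> e 0" | "e m \<le> ereal t"
        using elim by blast
      \<comment> \<open>On either side of the support one indicator is zero and the tail
        accompanying the other one vanishes.\<close>
      then have "indicator {..x} t * pd.Pl j t = 0 \<and> indicator {x<..} t * pd.Pu j t = 0"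
      proof cases
        case 1
        then have "t < x"
          using supp_bounds(1)[OF x] by (metis ereal_less(2) less_ereal.simps(1) order_le_less_trans)
        moreover have "p s = 0" if "s \<le> t" for s
          using that 1 by (intro p_null_lower) (metis ereal_less_eq(3) order_trans)
        ultimately show ?thesis
          by (simp add: pd.Pl_null)
      next
        case 2
        then have "x < t"
          using supp_bounds(2)[OF x] by (metis less_ereal.simps(1) order_less_le_trans)
        moreover have "p s = 0" if "t \<le> s" for s
          using that 2 by (intro p_null_upper) (metis ereal_less_eq(3) order_trans)
        ultimately show ?thesis
          by (simp add: pd.Pu_null)
      qed
      moreover have "p t = 0" using False by (rule p_null)
      ultimately show ?thesis by auto
    qed
  qed
  have meas: "(\<lambda>t. p t * K i j x t) \<in> borel_measurable lborel"
    using measurable_K[OF j', of i x] by measurable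
  have g_int: "integrable lborel ?g"
    using int by (intro Bochner_Integration.integrable_diff integrable_mult_right)
  have "integrable lborel (\<lambda>t. p t * K i j x t)"
    by (rule integrable_cong_AE_imp[OF g_int meas ae[THEN AE_symmetric]])
  then show "integrable M (\<lambda>\<omega>. K i j x (Z \<omega>))"
    by (simp add: integrable_Z[OF measurable_K[OF j']])
  have "expectation (\<lambda>\<omega>. K i j x (Z \<omega>)) = (LBINT t. ?g t)"
    unfolding expectation_Z[OF measurable_K[OF j']]
    by (rule integral_cong_AE[OF meas borel_measurable_integrable[OF g_int] ae])
  also have "\<dots> = (- 1) ^ j * ?u * pd.Pl (Suc j) x - ?l * pd.Pu (Suc j) x"
    unfolding pd.Pl_Suc[OF mom] pd.Pu_Suc[OF mom] using int by simp
  also have "\<dots> = MM i (int j) x"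
    unfolding stein_M_def using j by (simp add: lowerP_eq upperP_eq nat_add_distrib power_int_of_nat del: pd.Pl.simps pd.Pu.simps lowerP.simps upperP.simps)
  finally show "expectation (\<lambda>\<omega>. K i j x (Z \<omega>)) = MM i (int j) x" .
qed

text \<open>Write \<open>H\<close> for the part of the mean of \<open>h\<close> up to
  \<open>x\<close>. The kernel gives \<open>H\<close> times the upper tail minus
  \<open>Eh - H\<close> times the lower tail, and this is \<open>H\<close> minus \<open>Eh\<close>
  times the lower tail because the tails sum to 1.\<close>

lemma stein_solution_eq:
  assumes h: "integrable (density lborel (\<lambda>x. ennreal (p x))) h" and x: "x \<in> supp"
  shows "stein_solution p w (e 0) (expectation (\<lambda>\<omega>. h (Z \<omega>))) h x
    = expectation (\<lambda>\<omega>. K 0 0 x (Z \<omega>) * h (Z \<omega>))"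
proof -
  have h_meas [measurable]: "h \<in> borel_measurable borel"
    using borel_measurable_integrable[OF h] by simp
  have h_int: "integrable lborel (\<lambda>t. p t * h t)"
    using h p_nonneg by (simp add: integrable_density)
  define Eh where "Eh = expectation (\<lambda>\<omega>. h (Z \<omega>))"
  have Eh: "Eh = (LBINT t. p t * h t)"
    unfolding Eh_def by (rule expectation_Z[OF h_meas])
  have ind_int: "integrable lborel (\<lambda>t. indicator {..x} t * (p t * h t))"
    using integrable_mult_indicator[OF _ h_int, of "{..x}"] by simp
  have p_int: "integrable lborel (\<lambda>t. indicator {..x} t * p t)"
    using pd.moment_shift[OF pd.moment_0, of "{..x}"] by simp
  define H where "H = (LBINT t. indicator {..x} t * (p t * h t))"
  define mu ml where "mu = m_upper p w (e m) x" and "ml = m_lower p w (e 0) x"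
  have wp: "w x \<noteq> 0" "p x \<noteq> 0"
    using x w_nonzero p_pos_iff[of x] by auto
  have m: "mu = pd.Pu 1 x / (w x * p x)" "ml = pd.Pl 1 x / (w x * p x)"
    unfolding mu_def ml_def m_upper_def m_lower_def
    by (subst lowerP_eq upperP_eq; simp)+
  have sum: "pd.Pl 1 x + pd.Pu 1 x = 1"
    using pd.tails_sum[of x] by simp
  have "(\<lambda>t. K 0 0 x t * h t) \<in> borel_measurable borel"
    using measurable_K[of 0] by measurable
  then have "expectation (\<lambda>\<omega>. K 0 0 x (Z \<omega>) * h (Z \<omega>)) = (LBINT t. p t * (K 0 0 x t * h t))"
    by (rule expectation_Z)
  also have "\<dots> = (LBINT t. mu * (indicator {..x} t * (p t * h t))
      - ml * (p t * h t - indicator {..x} t * (p t * h t)))"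
    by (rule Bochner_Integration.integral_cong)
       (auto simp: stein_K_def mu_def ml_def indicator_def)
  also have "\<dots> = mu * H - ml * (Eh - H)"
    using ind_int h_int by (simp add: H_def Eh)
  also have "\<dots> = (H * (pd.Pl 1 x + pd.Pu 1 x) - pd.Pl 1 x * Eh) / (w x * p x)"
    unfolding m using wp by (simp add: field_simps del: pd.Pl.simps pd.Pu.simps)
  finally have 1: "expectation (\<lambda>\<omega>. K 0 0 x (Z \<omega>) * h (Z \<omega>)) = (H - pd.Pl 1 x * Eh) / (w x * p x)"
    unfolding sum by simp
  have "(LBINT t=e 0..ereal x. (h t - Eh) * p t) = (LBINT t. indicator {..x} t * ((h t - Eh) * p t))"
    by (rule interval_integral_lower) (simp add: p_null_lower)
  also have "\<dots> = (LBINT t. indicator {..x} t * (p t * h t) - Eh * (indicator {..x} t * p t))"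
    by (rule Bochner_Integration.integral_cong) (simp_all add: algebra_simps)
  also have "\<dots> = H - pd.Pl 1 x * Eh"
    using ind_int p_int by (simp add: H_def lower_tail_def)
  finally show ?thesis
    unfolding 1 by (simp add: stein_solution_def Eh_def)
qed

end

subsection \<open>Derivatives of the Stein solution\<close>

context pearson_stein
begin

text \<open>\<open>\<phi>\<close> is tied to the polynomial over \<open>w\<close> on the support
  only, which is where the Stein kernel is known to be that polynomial.\<close>

context
  fixes \<phi> \<phi>' :: "real \<Rightarrow> real" and c :: real
  assumes \<phi>: "\<And>x. x \<in> supp \<Longrightarrow> \<phi> x = pd.\<tau> x / w x"
    and DERIV_\<phi>: "\<And>x. x \<in> supp \<Longrightarrow> (\<phi> has_real_derivative \<phi>' x) (at x)"
    and DERIV_\<phi>': "\<And>x. x \<in> supp \<Longrightarrow> (\<phi>' has_real_derivative c) (at x)"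
begin

lemma inverse_w: "x \<in> supp \<Longrightarrow> 1 / w x = \<phi> x / pd.\<tau> x"
  using pd.\<tau>_pos[of x] w_nonzero[of x] by (simp add: \<phi>)

text \<open>Differentiability is inherited from \<open>\<phi> / \<tau>\<close>, a quotient of
  differentiable functions.\<close>

lemma differentiable_inverse_w:
  assumes "x \<in> supp"
  shows "(\<lambda>y. 1 / w y) differentiable (at x)"
proof -
  have "((\<lambda>y. \<phi> y / pd.\<tau> y) has_real_derivative
      (\<phi>' x * pd.\<tau> x - \<phi> x * pd.\<tau>' x) / (pd.\<tau> x * pd.\<tau> x)) (at x)"
    using assms pd.\<tau>_pos[OF assms] by (intro DERIV_divide DERIV_\<phi> pd.DERIV_\<tau>) auto
  from has_field_derivative_transform_within_open[OF this open_supp assms inverse_w[symmetric]]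
  show ?thesis
    by (auto simp: real_differentiable_def)
qed

text \<open>Since \<open>T = \<tau> * p\<close>, dividing by \<open>w * p\<close> is multiplying by
  \<open>\<phi>\<close> and dividing by \<open>T\<close>; hence the two functions are \<phi> times
  \<open>pd.A 0\<close> and \<open>pd.B 0\<close>.\<close>

lemma
  assumes x: "x \<in> supp" and k: "k \<le> n"
  shows deriv_m_upper: "(deriv ^^ k) (m_upper p w (e m)) x = leibniz pd.A \<phi> \<phi>' c k x"
    and deriv_m_lower: "(deriv ^^ k) (m_lower p w (e 0)) x = leibniz pd.B \<phi> \<phi>' c k x"
proof -
  have eq: "\<phi> y * (P / pd.T y) = P / (w y * p y)" if "y \<in> supp" for y P
    using pd.\<tau>_pos[OF that] w_nonzero[OF that] pd.pos[OF that]
    by (simp add: \<phi>[OF that] pd.kernel_on[OF that, symmetric])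
  have "m_upper p w (e m) y = leibniz pd.A \<phi> \<phi>' c 0 y" if "y \<in> supp" for y
    using eq[OF that, of "pd.Pu 1 y"] upperP_eq[of 1 y]
    by (simp add: leibniz_def pd.A_def m_upper_def numeral_2_eq_2 del: upperP.simps)
  from iterated_deriv(1)[OF open_supp this pd.DERIV_leibniz_A[OF DERIV_\<phi> DERIV_\<phi>'] k x]
  show "(deriv ^^ k) (m_upper p w (e m)) x = leibniz pd.A \<phi> \<phi>' c k x"
    by simp
  have "m_lower p w (e 0) y = leibniz pd.B \<phi> \<phi>' c 0 y" if "y \<in> supp" for y
    using eq[OF that, of "pd.Pl 1 y"] lowerP_eq[of 1 y]
    by (simp add: leibniz_def pd.B_def m_lower_def numeral_2_eq_2 del: lowerP.simps)
  from iterated_deriv(1)[OF open_supp this pd.DERIV_leibniz_B[OF DERIV_\<phi> DERIV_\<phi>'] k x]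
  show "(deriv ^^ k) (m_lower p w (e 0)) x = leibniz pd.B \<phi> \<phi>' c k x"
    by simp
qed

text \<open>For \<open>k \<le> 1\<close> the correction term vanishes because \<open>k choose 2 = 0\<close>.\<close>

lemma MM_diag:
  assumes x: "x \<in> supp" and k: "k \<le> n"
  shows "MM k (int k - 1) x = - 1 / w x - real (k choose 2) * c / pearson_q \<kappa>2 (k - 1)"
proof (cases "k = 0")
  case True
  \<comment> \<open>For \<open>k = 0\<close> the second index is -1: the sign is
    \<open>(- 1) powi (- 1) = - 1\<close> and both tails are the density itself.\<close>
  have "- (m_upper p w (e m) x * p x) - m_lower p w (e 0) x * p x = - (pd.Pl 1 x + pd.Pu 1 x) / w x"
    using pd.pos[OF x] w_nonzero[OF x] lowerP_eq[of 1 x] upperP_eq[of 1 x]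
    by (simp add: m_upper_def m_lower_def field_simps del: lowerP.simps upperP.simps)
  also have "\<dots> = - 1 / w x"
    using pd.tails_sum[of x] by simp
  finally have "- (m_upper p w (e m) x * p x) - m_lower p w (e 0) x * p x = - 1 / w x" .
  then show ?thesis
    using True by (simp add: stein_M_def numeral_2_eq_2)
next
  case False
  then have "(- 1 :: real) powi (int k - 1) = (- 1) ^ (k - 1)" "nat (int k - 1 + 1) = k"
    by (simp_all add: power_int_def nat_diff_distrib)
  then show ?thesis
    using False pd.leibniz_AB[OF k _ x, of \<phi> \<phi>' c] k inverse_w[OF x]
    by (simp add: stein_M_def deriv_m_upper[OF x k] deriv_m_lower[OF x k] lowerP_eq upperP_eq)
qed

lemma
  assumes reg: "regular n h"
  defines "f \<equiv> stein_solution p w (e 0) (expectation (\<lambda>\<omega>. h (Z \<omega>))) h"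
  shows f_differentiable: "times_differentiable_on n f supp"
    and deriv_f: "\<And>k x. k < n \<Longrightarrow> x \<in> supp \<Longrightarrow> (deriv ^^ Suc k) f x
      = expectation (\<lambda>\<omega>. K (Suc k) k x (Z \<omega>) * (deriv ^^ k) h (Z \<omega>)) + (deriv ^^ k) h x / w x"
proof -
  let ?EK = "\<lambda>i j k x. expectation (\<lambda>\<omega>. K i j x (Z \<omega>) * (deriv ^^ k) h (Z \<omega>))"
  \<comment> \<open>The claimed closed forms of all derivatives: \<open>F 0\<close> is the solution,
    \<open>F (Suc j)\<close> its derivative of order \<open>j + 1\<close>.\<close>
  define F where "F k x = (case k of 0 \<Rightarrow> f x | Suc j \<Rightarrow> ?EK (Suc j) j j x + (deriv ^^ j) h x / w x)" for k x
  have h: "integrable (density lborel (\<lambda>x. ennreal (p x))) h"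
    and h_diff: "times_differentiable_on (n - 1) h supp"
    and kdiff: "\<And>k. k < n \<Longrightarrow> kernel_diff k k ((deriv ^^ k) h)"
    and kparts: "\<And>k. k + 1 < n \<Longrightarrow> kernel_parts (k + 1) k ((deriv ^^ k) h)"
    using reg by (auto simp: regular_def)
  have DEK: "(?EK k k k has_real_derivative ?EK (Suc k) k k x - MM k (int k - 1) x * (deriv ^^ k) h x) (at x)"
    if "k < n" "x \<in> supp" for k x
    using kdiff[OF that(1)] that(2) by (simp add: kernel_diff_def)
  have D: "(F k has_real_derivative F (Suc k) x) (at x)" if k: "k < n" and x: "x \<in> supp" for k x
  proof (cases k)
    case 0
    have "(?EK 0 0 0 has_real_derivative F (Suc 0) x) (at x)"
      using DEK[of 0 x] MM_diag[OF x, of 0] k x 0 by (simp add: F_def numeral_2_eq_2)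
    from has_field_derivative_transform_within_open[OF this open_supp x]
    show ?thesis
      using stein_solution_eq[OF h] 0 by (simp add: F_def f_def)
  next
    case (Suc j)
    \<comment> \<open>The constant by which \<open>MM k (k - 1)\<close> falls short of
      \<open>- 1 / w\<close>.\<close>
    define s where "s = real (k choose 2) * c / pearson_q \<kappa>2 (k - 1)"
    have MMk: "MM k (int j) y = - 1 / w y - s" if "y \<in> supp" for y
      using MM_diag[OF that, of k] k Suc by (simp add: s_def)
    \<comment> \<open>Integration by parts before differentiating: its boundary term cancels the
      summand with \<open>1 / w\<close> and leaves \<open>- s\<close> times the lower derivative of
      \<open>h\<close>.\<close>
    have eq: "?EK k k k y - s * (deriv ^^ j) h y = F k y" if "y \<in> supp" for y
    proof -
      have "?EK k j j y = ?EK k k k y + MM k (int j) y * (deriv ^^ j) h y"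
        using kparts[of j] that k Suc by (simp add: kernel_parts_def)
      then show ?thesis
        unfolding MMk[OF that] by (simp add: F_def Suc algebra_simps)
    qed
    have "(deriv ^^ j) h differentiable (at x)"
      using h_diff k x Suc by (auto simp: times_differentiable_on_def)
    then have "((deriv ^^ j) h has_real_derivative (deriv ^^ k) h x) (at x)"
      unfolding Suc by (simp add: DERIV_deriv_iff_real_differentiable)
    then have "((\<lambda>y. ?EK k k k y - s * (deriv ^^ j) h y) has_real_derivative
        ?EK (Suc k) k k x - MM k (int k - 1) x * (deriv ^^ k) h x - s * (deriv ^^ k) h x) (at x)"
      by (intro DERIV_diff DEK k x DERIV_cmult)
    \<comment> \<open>Differentiating at \<open>(k, k)\<close> involves the same
      \<open>MM k (k - 1)\<close> as the preceding integration by parts, so its contribution of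
      \<open>s\<close> cancels the one carried along.\<close>
    moreover have "?EK (Suc k) k k x - MM k (int k - 1) x * (deriv ^^ k) h x - s * (deriv ^^ k) h x = F (Suc k) x"
    proof -
      have "int k - 1 = int j"
        using Suc by simp
      then show ?thesis
        unfolding \<open>int k - 1 = int j\<close> MMk[OF x] by (simp add: F_def algebra_simps)
    qed
    ultimately show ?thesis
      using has_field_derivative_transform_within_open[OF _ open_supp x eq] by simp
  qed
  note I = iterated_deriv[where n = n and f = f and F = F and S = supp, OF open_supp _ D]
  have F0: "f x = F 0 x" for x
    by (simp add: F_def)
  show "times_differentiable_on n f supp"
    unfolding times_differentiable_on_def using I(2)[OF F0] by blast
  show "(deriv ^^ Suc k) f x = ?EK (Suc k) k k x + (deriv ^^ k) h x / w x"
    if "k < n" "x \<in> supp" for k x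
    using I(1)[OF F0, of "Suc k" x] that by (simp add: F_def)
qed

lemma MM_diag_differentiable:
  assumes "x \<in> supp"
  shows "(MM n (int n - 1) has_real_derivative - deriv (\<lambda>y. 1 / w y) x) (at x)"
proof -
  have "((\<lambda>y. 1 / w y) has_real_derivative deriv (\<lambda>y. 1 / w y) x) (at x)"
    using differentiable_inverse_w[OF assms] by (simp add: DERIV_deriv_iff_real_differentiable)
  from DERIV_diff[OF DERIV_minus[OF this] DERIV_const]
  have "((\<lambda>y. - (1 / w y) - real (n choose 2) * c / pearson_q \<kappa>2 (n - 1))
      has_real_derivative - deriv (\<lambda>y. 1 / w y) x) (at x)"
    by simp
  from has_field_derivative_transform_within_open[OF this open_supp assms]
  show ?thesis
    using MM_diag[OF _ order_refl] by simp
qed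

text \<open>Centring subtracts the constant times the mean of the kernel, which is \<open>MM\<close>
  by \<open>expectation_K\<close>; together with the term in \<open>1 / w\<close> from
  \<open>deriv_f\<close> this leaves the stated coefficient.\<close>

lemma centred_representation:
  assumes reg: "regular n h" and n: "1 \<le> n" and x: "x \<in> supp"
  defines "g \<equiv> \<lambda>\<omega>. K n (n - 1) x (Z \<omega>) * ((deriv ^^ (n - 1)) h (Z \<omega>) - (deriv ^^ (n - 1)) h x)"
  shows "integrable M g"
    and "(deriv ^^ n) (stein_solution p w (e 0) (expectation (\<lambda>\<omega>. h (Z \<omega>))) h) x
      = expectation g + (MM n (int n - 1) x + 1 / w x) * (deriv ^^ (n - 1)) h x"
proof -
  obtain k where k: "n = Suc k"
    using n by (cases n) auto
  let ?a = "(deriv ^^ k) h x"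
  have g: "g = (\<lambda>\<omega>. K n k x (Z \<omega>) * (deriv ^^ k) h (Z \<omega>) - K n k x (Z \<omega>) * ?a)"
    by (simp add: g_def k right_diff_distrib)
  have "kernel_diff k k ((deriv ^^ k) h)"
    using reg by (simp add: regular_def k)
  then have 1: "integrable M (\<lambda>\<omega>. K n k x (Z \<omega>) * (deriv ^^ k) h (Z \<omega>))"
    using x by (simp add: kernel_diff_def k)
  have 2: "integrable M (\<lambda>\<omega>. K n k x (Z \<omega>) * ?a)"
    using integrable_K[of k x n] x by (simp add: k)
  show "integrable M g"
    unfolding g by (rule Bochner_Integration.integrable_diff[OF 1 2])
  have "expectation g = expectation (\<lambda>\<omega>. K n k x (Z \<omega>) * (deriv ^^ k) h (Z \<omega>)) - MM n (int k) x * ?a"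
    unfolding g Bochner_Integration.integral_diff[OF 1 2]
    using expectation_K[of k x n] x by (simp add: k)
  then show "(deriv ^^ n) (stein_solution p w (e 0) (expectation (\<lambda>\<omega>. h (Z \<omega>))) h) x
      = expectation g + (MM n (int n - 1) x + 1 / w x) * (deriv ^^ (n - 1)) h x"
    using deriv_f[OF reg, of k x] x by (simp add: k algebra_simps del: funpow.simps)
qed

end

context
  fixes \<phi> \<phi>' :: "real \<Rightarrow> real"
  assumes \<phi>: "\<And>x. x \<in> supp \<Longrightarrow> \<phi> x = pd.\<tau> x / w x"
    and DERIV_\<phi>: "\<And>x. x \<in> supp \<Longrightarrow> (\<phi> has_real_derivative \<phi>' x) (at x)"
    and DERIV_\<phi>': "\<And>x. x \<in> supp \<Longrightarrow> (\<phi>' has_real_derivative 0) (at x)"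
begin

lemma MM_affine: "x \<in> supp \<Longrightarrow> MM n (int n - 1) x = - 1 / w x"
  using MM_diag[OF \<phi> DERIV_\<phi> DERIV_\<phi>' _ order_refl] by simp

lemma MM_affine_n:
  assumes x: "x \<in> supp" and n: "1 \<le> n"
  shows "MM n (int n) x = - (real n / pearson_q \<kappa>2 n * \<phi>' x)"
proof -
  have "nat (int n + 1) = Suc n"
    by simp
  then show ?thesis
    using pd.leibniz_AB_Suc[OF order_refl n x, of \<phi> \<phi>'] deriv_m_upper[OF \<phi> DERIV_\<phi> DERIV_\<phi>' x order_refl]
      deriv_m_lower[OF \<phi> DERIV_\<phi> DERIV_\<phi>' x order_refl] lowerP_eq[of "Suc n" x] upperP_eq[of "Suc n" x]
    by (simp add: stein_M_def del: lowerP.simps upperP.simps pd.Pl.simps pd.Pu.simps)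
qed

text \<open>The boundary term of the integration by parts at \<open>(n, n - 1)\<close> has
  coefficient \<open>- 1 / w\<close> and cancels the pointwise term of
  \<open>deriv_f\<close>.\<close>

lemma representation_n:
  assumes reg: "regular_n n h" and n: "1 \<le> n" and x: "x \<in> supp"
  shows "(deriv ^^ n) (stein_solution p w (e 0) (expectation (\<lambda>\<omega>. h (Z \<omega>))) h) x
    = expectation (\<lambda>\<omega>. K n n x (Z \<omega>) * (deriv ^^ n) h (Z \<omega>))"
proof -
  obtain k where k: "n = Suc k"
    using n by (cases n) auto
  have r: "regular n h" and "kernel_parts n k ((deriv ^^ k) h)"
    using reg by (auto simp: regular_n_def k)
  then have "expectation (\<lambda>\<omega>. K n k x (Z \<omega>) * (deriv ^^ k) h (Z \<omega>))
      = expectation (\<lambda>\<omega>. K n n x (Z \<omega>) * (deriv ^^ n) h (Z \<omega>)) + MM n (int k) x * (deriv ^^ k) h x"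
    using x by (simp add: kernel_parts_def k)
  then show ?thesis
    using deriv_f[OF \<phi> DERIV_\<phi> DERIV_\<phi>' r, of k x] MM_affine[OF x] x
    by (simp add: k del: funpow.simps)
qed

text \<open>One more integration by parts, at \<open>(n, n)\<close>; its boundary coefficient
  \<open>MM n n\<close> is the pointwise term.\<close>

lemma representation_Suc_n:
  assumes reg: "regular_Suc_n n h" and n: "1 \<le> n" and x: "x \<in> supp"
  shows "(deriv ^^ n) (stein_solution p w (e 0) (expectation (\<lambda>\<omega>. h (Z \<omega>))) h) x
    = expectation (\<lambda>\<omega>. K n (n + 1) x (Z \<omega>) * (deriv ^^ (n + 1)) h (Z \<omega>))
      - real n / pearson_q \<kappa>2 n * \<phi>' x * (deriv ^^ n) h x"
proof -
  have r: "regular_n n h" and "kernel_parts n n ((deriv ^^ n) h)"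
    using reg by (auto simp: regular_Suc_n_def)
  then have "expectation (\<lambda>\<omega>. K n n x (Z \<omega>) * (deriv ^^ n) h (Z \<omega>))
      = expectation (\<lambda>\<omega>. K n (n + 1) x (Z \<omega>) * (deriv ^^ (n + 1)) h (Z \<omega>)) + MM n (int n) x * (deriv ^^ n) h x"
    using x by (simp add: kernel_parts_def)
  then show ?thesis
    using representation_n[OF r n x] MM_affine_n[OF x n] by simp
qed

end

end

section \<open>Assembly of the three cases\<close>

theorem theorem3p6:
  fixes M :: "'a measure" and Z :: "'a \<Rightarrow> real" and p w h :: "real \<Rightarrow> real"
    and m n :: nat and e :: "nat \<Rightarrow> ereal" and \<kappa>2 \<kappa>1 \<kappa>0 :: real
  defines "I \<equiv> supp_set m e"
    and "E \<equiv> (\<lambda>X :: 'a \<Rightarrow> real. integral\<^sup>L M X)"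
    and "\<tau> \<equiv> stein_kernel p (e 0) (integral\<^sup>L M Z)"
    and "K \<equiv> stein_K p w (e 0) (e m)"
    and "MM \<equiv> stein_M p w (e 0) (e m)"
    and "f \<equiv> stein_solution p w (e 0) (integral\<^sup>L M (\<lambda>\<omega>. h (Z \<omega>))) h"
  assumes setting: "stein_setting M Z p w m e"
    and pearson: "stein_setting.integrated_pearson M Z p m e \<kappa>2 \<kappa>1 \<kappa>0"
    and n: "1 \<le> n" "admissible \<kappa>2 n"
    and regular: "stein_setting.regular M Z p w m e n h"
  shows
    "(\<forall>c. (\<forall>x\<in>I. (\<lambda>y. \<tau> y / w y) differentiable (at x) \<and>
            (deriv (\<lambda>y. \<tau> y / w y) has_real_derivative c) (at x)) \<longrightarrow>
        (\<forall>x\<in>I. (\<lambda>y. 1 / w y) differentiable (at x) \<and>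
            (MM n (int n - 1) has_real_derivative - deriv (\<lambda>y. 1 / w y) x) (at x)) \<and>
        times_differentiable_on n f I \<and>
        (\<forall>x\<in>I. integrable M (\<lambda>\<omega>. K n (n - 1) x (Z \<omega>) *
            ((deriv ^^ (n - 1)) h (Z \<omega>) - (deriv ^^ (n - 1)) h x))) \<and>
        (\<forall>x\<in>I. (deriv ^^ n) f x =
            E (\<lambda>\<omega>. K n (n - 1) x (Z \<omega>) *
              ((deriv ^^ (n - 1)) h (Z \<omega>) - (deriv ^^ (n - 1)) h x))
            + (MM n (int n - 1) x + 1 / w x) * (deriv ^^ (n - 1)) h x) \<and>
        (n = 1 \<or> c = 0 \<longrightarrow> (\<forall>x\<in>I. (deriv ^^ n) f x =
            E (\<lambda>\<omega>. K n (n - 1) x (Z \<omega>) *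
              ((deriv ^^ (n - 1)) h (Z \<omega>) - (deriv ^^ (n - 1)) h x))))) \<and>
     (\<forall>c. (\<forall>x\<in>I. ((\<lambda>y. \<tau> y / w y) has_real_derivative c) (at x)) \<longrightarrow>
        (\<forall>x\<in>I. MM n (int n - 1) x = - 1 / w x) \<and>
        (stein_setting.regular_n M Z p w m e n h \<longrightarrow>
          times_differentiable_on n f I \<and>
          (\<forall>x\<in>I. (deriv ^^ n) f x =
            E (\<lambda>\<omega>. K n n x (Z \<omega>) * (deriv ^^ n) h (Z \<omega>)))) \<and>
        (stein_setting.regular_Suc_n M Z p w m e n h \<longrightarrow>
          (\<forall>x\<in>I. (deriv ^^ n) f x =
            E (\<lambda>\<omega>. K n (n + 1) x (Z \<omega>) * (deriv ^^ (n + 1)) h (Z \<omega>))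
            - real n / pearson_q \<kappa>2 n * deriv (\<lambda>y. \<tau> y / w y) x * (deriv ^^ n) h x))) \<and>
     ((\<forall>x\<in>I. w x = \<tau> x) \<and> stein_setting.regular_Suc_n M Z p w m e n h \<longrightarrow>
        times_differentiable_on n f I \<and>
        (\<forall>x\<in>I. real n / pearson_q \<kappa>2 n * deriv (\<lambda>y. \<tau> y / w y) x * (deriv ^^ n) h x = 0 \<and>
          (deriv ^^ n) f x =
            E (\<lambda>\<omega>. K n (n + 1) x (Z \<omega>) * (deriv ^^ (n + 1)) h (Z \<omega>))))"
proof -
  interpret stein_setting M Z p w m e
    by (rule setting)
  interpret pearson_stein M Z p w m e \<kappa>2 \<kappa>1 \<kappa>0 n
    by unfold_locales (rule pearson n)+
  let ?\<phi> = "\<lambda>y. \<tau> y / w y"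
  have \<phi>: "?\<phi> x = pd.\<tau> x / w x" if "x \<in> I" for x
    using stein_kernel_eq that by (simp add: I_def \<tau>_def)
  have part1: "(\<forall>x\<in>I. (\<lambda>y. 1 / w y) differentiable (at x) \<and>
            (MM n (int n - 1) has_real_derivative - deriv (\<lambda>y. 1 / w y) x) (at x)) \<and>
        times_differentiable_on n f I \<and>
        (\<forall>x\<in>I. integrable M (\<lambda>\<omega>. K n (n - 1) x (Z \<omega>) *
            ((deriv ^^ (n - 1)) h (Z \<omega>) - (deriv ^^ (n - 1)) h x))) \<and>
        (\<forall>x\<in>I. (deriv ^^ n) f x =
            E (\<lambda>\<omega>. K n (n - 1) x (Z \<omega>) *
              ((deriv ^^ (n - 1)) h (Z \<omega>) - (deriv ^^ (n - 1)) h x))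
            + (MM n (int n - 1) x + 1 / w x) * (deriv ^^ (n - 1)) h x) \<and>
        (n = 1 \<or> c = 0 \<longrightarrow> (\<forall>x\<in>I. (deriv ^^ n) f x =
            E (\<lambda>\<omega>. K n (n - 1) x (Z \<omega>) *
              ((deriv ^^ (n - 1)) h (Z \<omega>) - (deriv ^^ (n - 1)) h x))))"
    if "\<forall>x\<in>I. ?\<phi> differentiable (at x) \<and> (deriv ?\<phi> has_real_derivative c) (at x)" for c
  proof -
    have D: "(?\<phi> has_real_derivative deriv ?\<phi> x) (at x)" "(deriv ?\<phi> has_real_derivative c) (at x)"
      if "x \<in> I" for x
      using \<open>\<forall>x\<in>I. _ x\<close> that by (auto simp: DERIV_deriv_iff_real_differentiable)
    note * = \<phi>[unfolded I_def] D[unfolded I_def]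
    \<comment> \<open>The constant in \<open>MM_diag\<close> contains \<open>n choose 2\<close> and
      \<open>c\<close>, one of which is zero in either case.\<close>
    have correction: "MM n (int n - 1) x + 1 / w x = 0" if "n = 1 \<or> c = 0" "x \<in> I" for x
      using MM_diag[OF *, of x n] that by (auto simp: I_def MM_def numeral_2_eq_2)
    have rep: "(deriv ^^ n) f x =
            E (\<lambda>\<omega>. K n (n - 1) x (Z \<omega>) *
              ((deriv ^^ (n - 1)) h (Z \<omega>) - (deriv ^^ (n - 1)) h x))
            + (MM n (int n - 1) x + 1 / w x) * (deriv ^^ (n - 1)) h x" if "x \<in> I" for x
      using centred_representation(2)[OF * regular n(1)] that
      unfolding I_def f_def E_def K_def MM_def by blast
    show ?thesis
      using differentiable_inverse_w[OF *] MM_diag_differentiable[OF *] f_differentiable[OF * regular]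
        centred_representation(1)[OF * regular n(1)] rep correction
      by (auto simp: I_def f_def K_def MM_def)
  qed
  \<comment> \<open>The affine case is the quadratic one with second derivative 0: on the open
    support the first derivative is the constant \<open>c\<close>.\<close>
  have affine: "(deriv ?\<phi> has_real_derivative 0) (at x)" "deriv ?\<phi> x = c"
    if "\<forall>x\<in>I. (?\<phi> has_real_derivative c) (at x)" "x \<in> I" for c x
  proof -
    have eq: "deriv ?\<phi> y = c" if "y \<in> I" for y
      using \<open>\<forall>x\<in>I. _ x\<close> that by (simp add: DERIV_imp_deriv)
    show "(deriv ?\<phi> has_real_derivative 0) (at x)"
      by (rule has_field_derivative_transform_within_open[OF DERIV_const[of c] open_supp])
         (use eq \<open>x \<in> I\<close> in \<open>auto simp: I_def\<close>)
    show "deriv ?\<phi> x = c"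
      using eq \<open>x \<in> I\<close> .
  qed
  have part2: "(\<forall>x\<in>I. MM n (int n - 1) x = - 1 / w x) \<and>
        (regular_n n h \<longrightarrow>
          times_differentiable_on n f I \<and>
          (\<forall>x\<in>I. (deriv ^^ n) f x =
            E (\<lambda>\<omega>. K n n x (Z \<omega>) * (deriv ^^ n) h (Z \<omega>)))) \<and>
        (regular_Suc_n n h \<longrightarrow>
          (\<forall>x\<in>I. (deriv ^^ n) f x =
            E (\<lambda>\<omega>. K n (n + 1) x (Z \<omega>) * (deriv ^^ (n + 1)) h (Z \<omega>))
            - real n / pearson_q \<kappa>2 n * deriv ?\<phi> x * (deriv ^^ n) h x))"
    if c: "\<forall>x\<in>I. (?\<phi> has_real_derivative c) (at x)" for c
  proof -
    have D: "(?\<phi> has_real_derivative deriv ?\<phi> x) (at x)" if "x \<in> I" for x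
      using c that affine(2)[OF c that] by simp
    note * = \<phi>[unfolded I_def] D[unfolded I_def] affine(1)[OF c, unfolded I_def]
    show ?thesis
      using MM_affine[OF *] f_differentiable[OF * regular] representation_n[OF * _ n(1)]
        representation_Suc_n[OF * _ n(1)]
      unfolding I_def f_def K_def MM_def E_def by blast
  qed
  have part3: "times_differentiable_on n f I \<and>
        (\<forall>x\<in>I. real n / pearson_q \<kappa>2 n * deriv ?\<phi> x * (deriv ^^ n) h x = 0 \<and>
          (deriv ^^ n) f x =
            E (\<lambda>\<omega>. K n (n + 1) x (Z \<omega>) * (deriv ^^ (n + 1)) h (Z \<omega>)))"
    if w: "\<forall>x\<in>I. w x = \<tau> x" and reg: "regular_Suc_n n h"
  proof -
    \<comment> \<open>The quotient is 1 because \<open>w\<close> is nonzero on the support, so the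
      affine case applies with slope 0.\<close>
    have one: "?\<phi> x = 1" if "x \<in> I" for x
      using w w_nonzero[of x] that by (simp add: I_def)
    have c: "\<forall>x\<in>I. (?\<phi> has_real_derivative 0) (at x)"
    proof
      fix x assume "x \<in> I"
      then have x: "x \<in> supp"
        by (simp add: I_def)
      show "(?\<phi> has_real_derivative 0) (at x)"
      proof (rule has_field_derivative_transform_within_open[OF DERIV_const open_supp x])
        show "1 = \<tau> y / w y" if "y \<in> supp" for y
          using one[of y] that by (simp only: I_def)
      qed
    qed
    have r: "regular_n n h"
      using reg by (simp add: regular_Suc_n_def)
    then have "times_differentiable_on n f I"
      using part2[OF c] by blast
    moreover have "\<forall>x\<in>I. (deriv ^^ n) f x =
            E (\<lambda>\<omega>. K n (n + 1) x (Z \<omega>) * (deriv ^^ (n + 1)) h (Z \<omega>))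
            - real n / pearson_q \<kappa>2 n * deriv ?\<phi> x * (deriv ^^ n) h x"
      using part2[OF c] reg by blast
    ultimately show ?thesis
      using affine(2)[OF c] by simp
  qed
  show ?thesis
    using part1 part2 part3 by blast
qed

end
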